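(* Let $E$ be a graph, $K$ any commutative unital ring and $A$ any $K$-algebra. Denote by $\rho\colon\mathbf{GL}_1\to\mathbf{aut}(L_K(E))$ the (schematic) gauge action of the Leavitt path algebra $L_K(E)$. Assume that $\phi\colon L_K(E)\to A$ is a $K$-algebra homomorphism such that $\phi(rv)\neq 0$ for every $v\in E^0$ and every $r\in K\setminus\{0\}$. If there exists an action $\sigma\colon\mathbf{GL}_1\to\mathbf{aut}(A)$ such that $(\phi\otimes 1)\rho_R(z)=\sigma_R(z)(\phi\otimes 1)$ (as maps $L_K(E)\otimes_K R\to A\otimes_K R$) for every associative, commutative, unital $K$-algebra $R$ and every $z\in R^\times$, then $\phi$ is injective.
   Context: A graph $E=(E^0,E^1,r,s)$ consists of a set of vertices $E^0$, a set of edges $E^1$, and maps $s,r\colon E^1\to E^0$ (source and range). A vertex $v$ is regular if $s^{-1}(v)$ is nonempty and finite. The Leavitt path algebra $L_K(E)$ over a commutative unital ring $K$ is the associative $K$-algebra generated by $E^0\cup E^1\cup\{f^*: f\in E^1\}$ subject to the relations: $uv=\delta_{u,v}u$ for $u,v\in E^0$; $s(f)f=f=f r(f)$ and $r(f)f^*=f^*=f^*s(f)$ for $f\in E^1$; $f^*g=\delta_{f,g}r(f)$ for $f,g\in E^1$; and $v=\sum_{s(f)=v}ff^*$ for each regular vertex $v$. Let $\mathbf{alg}_K$ be the category of associative commutative unital $K$-algebras. For $R$ in $\mathbf{alg}_K$, $R^\times$ is the group of invertible elements of $R$. $\mathbf{GL}_1$ is the group functor $R\mapsto R^\times$ on $\mathbf{alg}_K$,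 and for a $K$-algebra $A$, $\mathbf{aut}(A)$ is the group functor $R\mapsto \mathrm{Aut}_R(A\otimes_K R)$ ($R$-algebra automorphisms). An action $\sigma\colon\mathbf{GL}_1\to\mathbf{aut}(A)$ is a natural transformation of group functors; $\sigma_R\colon R^\times\to\mathrm{Aut}_R(A\otimes_K R)$ denotes its component at $R$. The (schematic) gauge action of $L_K(E)$ is the action $\rho\colon\mathbf{GL}_1\to\mathbf{aut}(L_K(E))$ such that for every $R$ in $\mathbf{alg}_K$ and $z\in R^\times$: $\rho_R(z)(u\otimes 1)=u\otimes 1$ for $u\in E^0$, and $\rho_R(z)(f\otimes 1)=f\otimes z$, $\rho_R(z)(f^*\otimes 1)=f^*\otimes z^{-1}$ for $f\in E^1$. *)

theory Defs
  imports "HOL-Algebra.Module" "HOL-Algebra.Bij" "HOL-Algebra.QuotRing" "HOL-Algebra.Free_Abelian_Groups" "Graph_Theory.Digraph"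
begin

section \<open>Algebras over a commutative unital ring\<close>

text \<open>
  Algebras are records of type \<^typ>\<open>('k, 'a) module\<close>. The library's \<^const>\<open>algebra\<close> is the
  notion of an associative commutative unital algebra; below is the general notion, in which
  the multiplication is only assumed to be bilinear. Its \<open>one\<close> field carries no meaning.
\<close>

locale nonassoc_algebra = Module.module R M for R (structure) and M (structure) +
  assumes mult_closed:
      "\<lbrakk>x \<in> carrier M; y \<in> carrier M\<rbrakk> \<Longrightarrow> x \<otimes>\<^bsub>M\<^esub> y \<in> carrier M"
    and mult_add_left:
      "\<lbrakk>x \<in> carrier M; y \<in> carrier M; z \<in> carrier M\<rbrakk> \<Longrightarrow>
        (x \<oplus>\<^bsub>M\<^esub> y) \<otimes>\<^bsub>M\<^esub> z = x \<otimes>\<^bsub>M\<^esub> z \<oplus>\<^bsub>M\<^esub> y \<otimes>\<^bsub>M\<^esub> z"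
    and mult_add_right:
      "\<lbrakk>x \<in> carrier M; y \<in> carrier M; z \<in> carrier M\<rbrakk> \<Longrightarrow>
        z \<otimes>\<^bsub>M\<^esub> (x \<oplus>\<^bsub>M\<^esub> y) = z \<otimes>\<^bsub>M\<^esub> x \<oplus>\<^bsub>M\<^esub> z \<otimes>\<^bsub>M\<^esub> y"
    and mult_smult_left:
      "\<lbrakk>k \<in> carrier R; x \<in> carrier M; y \<in> carrier M\<rbrakk> \<Longrightarrow>
        (k \<odot>\<^bsub>M\<^esub> x) \<otimes>\<^bsub>M\<^esub> y = k \<odot>\<^bsub>M\<^esub> (x \<otimes>\<^bsub>M\<^esub> y)"
    and mult_smult_right:
      "\<lbrakk>k \<in> carrier R; x \<in> carrier M; y \<in> carrier M\<rbrakk> \<Longrightarrow>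
        x \<otimes>\<^bsub>M\<^esub> (k \<odot>\<^bsub>M\<^esub> y) = k \<odot>\<^bsub>M\<^esub> (x \<otimes>\<^bsub>M\<^esub> y)"

definition alg_hom ::
    "('k, 'm) ring_scheme \<Rightarrow> ('k, 'a) module \<Rightarrow> ('k, 'b) module \<Rightarrow> ('a \<Rightarrow> 'b) set" where
  "alg_hom K A B = {h.
     (\<forall>x\<in>carrier A. h x \<in> carrier B) \<and>
     (\<forall>x\<in>carrier A. \<forall>y\<in>carrier A. h (x \<oplus>\<^bsub>A\<^esub> y) = h x \<oplus>\<^bsub>B\<^esub> h y) \<and>
     (\<forall>x\<in>carrier A. \<forall>y\<in>carrier A. h (x \<otimes>\<^bsub>A\<^esub> y) = h x \<otimes>\<^bsub>B\<^esub> h y) \<and>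
     (\<forall>k\<in>carrier K. \<forall>x\<in>carrier A. h (k \<odot>\<^bsub>A\<^esub> x) = k \<odot>\<^bsub>B\<^esub> h x)}"

definition unital_alg_hom ::
    "('k, 'm) ring_scheme \<Rightarrow> ('k, 'a) module \<Rightarrow> ('k, 'b) module \<Rightarrow> ('a \<Rightarrow> 'b) set" where
  "unital_alg_hom K R S = {h \<in> alg_hom K R S. h \<one>\<^bsub>R\<^esub> = \<one>\<^bsub>S\<^esub>}"

definition alg_Aut :: "('k, 'm) ring_scheme \<Rightarrow> ('k, 'a) module \<Rightarrow> ('a \<Rightarrow> 'a) monoid" where
  "alg_Aut K A = BijGroup (carrier A) \<lparr>carrier := alg_hom K A A \<inter> Bij (carrier A)\<rparr>"


section \<open>Associative algebras given by generators and relations\<close>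

datatype ('k, 'x) alg_term =
    Gen 'x
  | Null
  | Sum "('k, 'x) alg_term" "('k, 'x) alg_term"
  | Neg "('k, 'x) alg_term"
  | Scale 'k "('k, 'x) alg_term"
  | Prod "('k, 'x) alg_term" "('k, 'x) alg_term"

inductive_set alg_terms :: "('k, 'm) ring_scheme \<Rightarrow> 'x set \<Rightarrow> ('k, 'x) alg_term set"
  for K :: "('k, 'm) ring_scheme" and X :: "'x set" where
  "x \<in> X \<Longrightarrow> Gen x \<in> alg_terms K X"
| "Null \<in> alg_terms K X"
| "\<lbrakk>s \<in> alg_terms K X; t \<in> alg_terms K X\<rbrakk> \<Longrightarrow> Sum s t \<in> alg_terms K X"
| "s \<in> alg_terms K X \<Longrightarrow> Neg s \<in> alg_terms K X"
| "\<lbrakk>k \<in> carrier K; s \<in> alg_terms K X\<rbrakk> \<Longrightarrow> Scale k s \<in> alg_terms K X"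
| "\<lbrakk>s \<in> alg_terms K X; t \<in> alg_terms K X\<rbrakk> \<Longrightarrow> Prod s t \<in> alg_terms K X"

text \<open>
  The least congruence on terms that contains the given relations and forces the axioms of an
  associative (not necessarily unital) algebra over \<open>K\<close>.
\<close>

inductive_set alg_cong ::
    "('k, 'm) ring_scheme \<Rightarrow> 'x set \<Rightarrow> (('k, 'x) alg_term \<times> ('k, 'x) alg_term) set \<Rightarrow>
     (('k, 'x) alg_term \<times> ('k, 'x) alg_term) set"
  for K :: "('k, 'm) ring_scheme" and X :: "'x set"
    and rels :: "(('k, 'x) alg_term \<times> ('k, 'x) alg_term) set" where
  rel: "\<lbrakk>(s, t) \<in> rels; s \<in> alg_terms K X; t \<in> alg_terms K X\<rbrakk> \<Longrightarrow> (s, t) \<in> alg_cong K X rels"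
| refl: "s \<in> alg_terms K X \<Longrightarrow> (s, s) \<in> alg_cong K X rels"
| sym: "(s, t) \<in> alg_cong K X rels \<Longrightarrow> (t, s) \<in> alg_cong K X rels"
| trans: "\<lbrakk>(s, t) \<in> alg_cong K X rels; (t, u) \<in> alg_cong K X rels\<rbrakk> \<Longrightarrow> (s, u) \<in> alg_cong K X rels"
| cong_Sum: "\<lbrakk>(s, s') \<in> alg_cong K X rels; (t, t') \<in> alg_cong K X rels\<rbrakk> \<Longrightarrow>
    (Sum s t, Sum s' t') \<in> alg_cong K X rels"
| cong_Neg: "(s, s') \<in> alg_cong K X rels \<Longrightarrow> (Neg s, Neg s') \<in> alg_cong K X rels"
| cong_Scale: "\<lbrakk>k \<in> carrier K; (s, s') \<in> alg_cong K X rels\<rbrakk> \<Longrightarrow>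
    (Scale k s, Scale k s') \<in> alg_cong K X rels"
| cong_Prod: "\<lbrakk>(s, s') \<in> alg_cong K X rels; (t, t') \<in> alg_cong K X rels\<rbrakk> \<Longrightarrow>
    (Prod s t, Prod s' t') \<in> alg_cong K X rels"
| Sum_assoc: "\<lbrakk>s \<in> alg_terms K X; t \<in> alg_terms K X; u \<in> alg_terms K X\<rbrakk> \<Longrightarrow>
    (Sum (Sum s t) u, Sum s (Sum t u)) \<in> alg_cong K X rels"
| Sum_comm: "\<lbrakk>s \<in> alg_terms K X; t \<in> alg_terms K X\<rbrakk> \<Longrightarrow> (Sum s t, Sum t s) \<in> alg_cong K X rels"
| Sum_Null: "s \<in> alg_terms K X \<Longrightarrow> (Sum s Null, s) \<in> alg_cong K X rels"
| Sum_Neg: "s \<in> alg_terms K X \<Longrightarrow> (Sum s (Neg s), Null) \<in> alg_cong K X rels"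
| Scale_add: "\<lbrakk>k \<in> carrier K; l \<in> carrier K; s \<in> alg_terms K X\<rbrakk> \<Longrightarrow>
    (Scale (k \<oplus>\<^bsub>K\<^esub> l) s, Sum (Scale k s) (Scale l s)) \<in> alg_cong K X rels"
| Scale_Sum: "\<lbrakk>k \<in> carrier K; s \<in> alg_terms K X; t \<in> alg_terms K X\<rbrakk> \<Longrightarrow>
    (Scale k (Sum s t), Sum (Scale k s) (Scale k t)) \<in> alg_cong K X rels"
| Scale_mult: "\<lbrakk>k \<in> carrier K; l \<in> carrier K; s \<in> alg_terms K X\<rbrakk> \<Longrightarrow>
    (Scale (k \<otimes>\<^bsub>K\<^esub> l) s, Scale k (Scale l s)) \<in> alg_cong K X rels"
| Scale_one: "s \<in> alg_terms K X \<Longrightarrow> (Scale \<one>\<^bsub>K\<^esub> s, s) \<in> alg_cong K X rels"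
| Prod_assoc: "\<lbrakk>s \<in> alg_terms K X; t \<in> alg_terms K X; u \<in> alg_terms K X\<rbrakk> \<Longrightarrow>
    (Prod (Prod s t) u, Prod s (Prod t u)) \<in> alg_cong K X rels"
| Prod_Sum_left: "\<lbrakk>s \<in> alg_terms K X; t \<in> alg_terms K X; u \<in> alg_terms K X\<rbrakk> \<Longrightarrow>
    (Prod (Sum s t) u, Sum (Prod s u) (Prod t u)) \<in> alg_cong K X rels"
| Prod_Sum_right: "\<lbrakk>s \<in> alg_terms K X; t \<in> alg_terms K X; u \<in> alg_terms K X\<rbrakk> \<Longrightarrow>
    (Prod u (Sum s t), Sum (Prod u s) (Prod u t)) \<in> alg_cong K X rels"
| Prod_Scale_left: "\<lbrakk>k \<in> carrier K; s \<in> alg_terms K X; t \<in> alg_terms K X\<rbrakk> \<Longrightarrow>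
    (Prod (Scale k s) t, Scale k (Prod s t)) \<in> alg_cong K X rels"
| Prod_Scale_right: "\<lbrakk>k \<in> carrier K; s \<in> alg_terms K X; t \<in> alg_terms K X\<rbrakk> \<Longrightarrow>
    (Prod s (Scale k t), Scale k (Prod s t)) \<in> alg_cong K X rels"

text \<open>
  The operations are lifted to congruence classes in the style of \<^const>\<open>rcoset_mult\<close>: the
  unions are over representatives, all of which yield the same class.
\<close>

definition presented_algebra ::
    "('k, 'm) ring_scheme \<Rightarrow> 'x set \<Rightarrow> (('k, 'x) alg_term \<times> ('k, 'x) alg_term) set \<Rightarrow>
     ('k, ('k, 'x) alg_term set) module" where
  "presented_algebra K X rels =
     \<lparr>carrier = alg_terms K X // alg_cong K X rels,
      monoid.mult = (\<lambda>S T. \<Union>s\<in>S. \<Union>t\<in>T. alg_cong K X rels `` {Prod s t}),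
      one = undefined,
      ring.zero = alg_cong K X rels `` {Null},
      add = (\<lambda>S T. \<Union>s\<in>S. \<Union>t\<in>T. alg_cong K X rels `` {Sum s t}),
      smult = (\<lambda>k S. \<Union>s\<in>S. alg_cong K X rels `` {Scale k s})\<rparr>"


section \<open>Leavitt path algebras\<close>

text \<open>A graph is a \<^const>\<open>wf_digraph\<close>; \<^const>\<open>tail\<close> is the source map and \<^const>\<open>head\<close> the range map.\<close>

definition regular_vertex :: "('v, 'e) pre_digraph \<Rightarrow> 'v \<Rightarrow> bool" where
  "regular_vertex E v \<longleftrightarrow> v \<in> verts E \<and>
     {f \<in> arcs E. tail E f = v} \<noteq> {} \<and> finite {f \<in> arcs E. tail E f = v}"

datatype ('v, 'e) leavitt_gen = Vertex 'v | Edge 'e | Ghost 'e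

definition leavitt_gens :: "('v, 'e) pre_digraph \<Rightarrow> ('v, 'e) leavitt_gen set" where
  "leavitt_gens E = Vertex ` verts E \<union> Edge ` arcs E \<union> Ghost ` arcs E"

text \<open>
  In the last relation \<open>fs\<close> is any enumeration of the edges leaving \<open>v\<close>, since a finite sum has to
  be written as a nested binary one.
\<close>

inductive_set leavitt_rels ::
    "('v, 'e) pre_digraph \<Rightarrow>
     (('k, ('v, 'e) leavitt_gen) alg_term \<times> ('k, ('v, 'e) leavitt_gen) alg_term) set"
  for E :: "('v, 'e) pre_digraph" where
  vertices: "\<lbrakk>u \<in> verts E; v \<in> verts E\<rbrakk> \<Longrightarrow>
    (Prod (Gen (Vertex u)) (Gen (Vertex v)), if u = v then Gen (Vertex u) else Null)
      \<in> leavitt_rels E"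
| source_edge: "f \<in> arcs E \<Longrightarrow>
    (Prod (Gen (Vertex (tail E f))) (Gen (Edge f)), Gen (Edge f)) \<in> leavitt_rels E"
| edge_range: "f \<in> arcs E \<Longrightarrow>
    (Prod (Gen (Edge f)) (Gen (Vertex (head E f))), Gen (Edge f)) \<in> leavitt_rels E"
| range_ghost: "f \<in> arcs E \<Longrightarrow>
    (Prod (Gen (Vertex (head E f))) (Gen (Ghost f)), Gen (Ghost f)) \<in> leavitt_rels E"
| ghost_source: "f \<in> arcs E \<Longrightarrow>
    (Prod (Gen (Ghost f)) (Gen (Vertex (tail E f))), Gen (Ghost f)) \<in> leavitt_rels E"
| ghost_edge: "\<lbrakk>f \<in> arcs E; g \<in> arcs E\<rbrakk> \<Longrightarrow>
    (Prod (Gen (Ghost f)) (Gen (Edge g)), if f = g then Gen (Vertex (head E f)) else Null)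
      \<in> leavitt_rels E"
| regular: "\<lbrakk>regular_vertex E v; distinct fs; set fs = {f \<in> arcs E. tail E f = v}\<rbrakk> \<Longrightarrow>
    (Gen (Vertex v), foldr (\<lambda>f t. Sum (Prod (Gen (Edge f)) (Gen (Ghost f))) t) fs Null)
      \<in> leavitt_rels E"

type_synonym ('k, 'v, 'e) leavitt = "('k, ('v, 'e) leavitt_gen) alg_term set"

definition leavitt_path_algebra ::
    "('k, 'm) ring_scheme \<Rightarrow> ('v, 'e) pre_digraph \<Rightarrow> ('k, ('k, 'v, 'e) leavitt) module" where
  "leavitt_path_algebra K E = presented_algebra K (leavitt_gens E) (leavitt_rels E)"

definition leavitt_gen ::
    "('k, 'm) ring_scheme \<Rightarrow> ('v, 'e) pre_digraph \<Rightarrow> ('v, 'e) leavitt_gen \<Rightarrow> ('k, 'v, 'e) leavitt" where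
  "leavitt_gen K E x = alg_cong K (leavitt_gens E) (leavitt_rels E) `` {Gen x}"


section \<open>Scalar extension\<close>

text \<open>
  \<open>A \<otimes>\<^sub>K R\<close> is the free abelian group on the set of pairs, with the multiplication
  \<open>(a, r) (b, s) = (a b, r s)\<close> extended biadditively, modulo the subgroup generated by the
  biadditivity and \<open>K\<close>-balancedness relators. It is regarded as an algebra over \<open>R\<close>.
\<close>

type_synonym ('a, 'r) tensor = "(('a \<times> 'r) \<Rightarrow>\<^sub>0 int) set"

definition tensor_pre :: "('k, 'a) module \<Rightarrow> ('k, 'r) module \<Rightarrow> (('a \<times> 'r) \<Rightarrow>\<^sub>0 int) ring" where
  "tensor_pre A R =
     \<lparr>carrier = carrier (free_Abelian_group (carrier A \<times> carrier R)),
      monoid.mult = (\<lambda>x y. frag_extend (\<lambda>(a, r).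
                frag_extend (\<lambda>(b, s). frag_of (a \<otimes>\<^bsub>A\<^esub> b, r \<otimes>\<^bsub>R\<^esub> s)) y) x),
      one = undefined,
      ring.zero = 0,
      add = (+)\<rparr>"

definition tensor_relators ::
    "('k, 'm) ring_scheme \<Rightarrow> ('k, 'a) module \<Rightarrow> ('k, 'r) module \<Rightarrow> (('a \<times> 'r) \<Rightarrow>\<^sub>0 int) set" where
  "tensor_relators K A R =
     {frag_of (a \<oplus>\<^bsub>A\<^esub> b, r) - frag_of (a, r) - frag_of (b, r) | a b r.
        a \<in> carrier A \<and> b \<in> carrier A \<and> r \<in> carrier R} \<union>
     {frag_of (a, r \<oplus>\<^bsub>R\<^esub> s) - frag_of (a, r) - frag_of (a, s) | a r s.
        a \<in> carrier A \<and> r \<in> carrier R \<and> s \<in> carrier R} \<union>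
     {frag_of (k \<odot>\<^bsub>A\<^esub> a, r) - frag_of (a, k \<odot>\<^bsub>R\<^esub> r) | k a r.
        k \<in> carrier K \<and> a \<in> carrier A \<and> r \<in> carrier R}"

definition tensor_null ::
    "('k, 'm) ring_scheme \<Rightarrow> ('k, 'a) module \<Rightarrow> ('k, 'r) module \<Rightarrow> (('a \<times> 'r) \<Rightarrow>\<^sub>0 int) set" where
  "tensor_null K A R =
     generate (free_Abelian_group (carrier A \<times> carrier R)) (tensor_relators K A R)"

definition tensor_class ::
    "('k, 'm) ring_scheme \<Rightarrow> ('k, 'a) module \<Rightarrow> ('k, 'r) module \<Rightarrow>
     (('a \<times> 'r) \<Rightarrow>\<^sub>0 int) \<Rightarrow> ('a, 'r) tensor" where
  "tensor_class K A R x = tensor_null K A R +>\<^bsub>tensor_pre A R\<^esub> x"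

definition tensor_algebra ::
    "('k, 'm) ring_scheme \<Rightarrow> ('k, 'a) module \<Rightarrow> ('k, 'r) module \<Rightarrow>
     ('r, ('a, 'r) tensor) module" where
  "tensor_algebra K A R =
     \<lparr>carrier = a_rcosets\<^bsub>tensor_pre A R\<^esub> (tensor_null K A R),
      monoid.mult = rcoset_mult (tensor_pre A R) (tensor_null K A R),
      one = undefined,
      ring.zero = tensor_null K A R,
      add = set_add (tensor_pre A R),
      smult = (\<lambda>r X. \<Union>x\<in>X.
        tensor_class K A R (frag_extend (\<lambda>(a, s). frag_of (a, r \<otimes>\<^bsub>R\<^esub> s)) x))\<rparr>"

definition pure_tensor ::
    "('k, 'm) ring_scheme \<Rightarrow> ('k, 'a) module \<Rightarrow> ('k, 'r) module \<Rightarrow> 'a \<Rightarrow> 'r \<Rightarrow> ('a, 'r) tensor" where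
  "pure_tensor K A R a r = tensor_class K A R (frag_of (a, r))"

text \<open>\<open>tensor_map K B S g h\<close> is the map \<open>g \<otimes> h\<close> into \<open>B \<otimes>\<^sub>K S\<close>.\<close>

definition tensor_map ::
    "('k, 'm) ring_scheme \<Rightarrow> ('k, 'b) module \<Rightarrow> ('k, 's) module \<Rightarrow>
     ('a \<Rightarrow> 'b) \<Rightarrow> ('r \<Rightarrow> 's) \<Rightarrow> ('a, 'r) tensor \<Rightarrow> ('b, 's) tensor" where
  "tensor_map K B S g h X =
     (\<Union>x\<in>X. tensor_class K B S (frag_extend (\<lambda>(a, r). frag_of (g a, h r)) x))"


section \<open>Actions of the multiplicative group scheme\<close>

text \<open>
  A family indexed by commutative algebras is a function on records \<open>R\<close> with elements in a type
  \<^typ>\<open>'r\<close>, of which only the values at those \<open>R\<close> with \<^term>\<open>algebra K R\<close> matter.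
  The group functor \<open>GL\<^sub>1\<close> is \<^const>\<open>units_of\<close>, with \<open>\<alpha> : R \<rightarrow> S\<close> acting by \<open>z \<mapsto> \<alpha> z\<close>.
\<close>

definition aut ::
    "('k, 'm) ring_scheme \<Rightarrow> ('k, 'a) module \<Rightarrow> ('k, 'r) module \<Rightarrow>
     (('a, 'r) tensor \<Rightarrow> ('a, 'r) tensor) monoid" where
  "aut K A R = alg_Aut R (tensor_algebra K A R)"

text \<open>
  The functor on a morphism \<open>\<alpha> : R \<rightarrow> S\<close>: base change of an \<open>R\<close>-automorphism of \<open>A \<otimes> R\<close> along \<open>\<alpha>\<close>
  under \<open>(A \<otimes> R) \<otimes>\<^sub>R S \<cong> A \<otimes> S\<close>. It is determined by its values at \<open>a \<otimes> 1\<close>, as these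
  generate \<open>A \<otimes> S\<close> over \<open>S\<close>.
\<close>

definition aut_map ::
    "('k, 'm) ring_scheme \<Rightarrow> ('k, 'a) module \<Rightarrow> ('k, 'r) module \<Rightarrow> ('k, 's) module \<Rightarrow> ('r \<Rightarrow> 's) \<Rightarrow>
     (('a, 'r) tensor \<Rightarrow> ('a, 'r) tensor) \<Rightarrow> (('a, 's) tensor \<Rightarrow> ('a, 's) tensor)" where
  "aut_map K A R S \<alpha> g = (THE h. h \<in> carrier (aut K A S) \<and>
     (\<forall>a\<in>carrier A. h (pure_tensor K A S a \<one>\<^bsub>S\<^esub>) =
        tensor_map K A S id \<alpha> (g (pure_tensor K A R a \<one>\<^bsub>R\<^esub>))))"

definition GL1_action ::
    "('k, 'm) ring_scheme \<Rightarrow> ('k, 'a) module \<Rightarrow>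
     (('k, 'r) module \<Rightarrow> 'r \<Rightarrow> ('a, 'r) tensor \<Rightarrow> ('a, 'r) tensor) \<Rightarrow> bool" where
  "GL1_action K A \<sigma> \<longleftrightarrow>
     (\<forall>R. algebra K R \<longrightarrow> \<sigma> R \<in> hom (units_of R) (aut K A R)) \<and>
     (\<forall>R S \<alpha> z. algebra K R \<longrightarrow> algebra K S \<longrightarrow> \<alpha> \<in> unital_alg_hom K R S \<longrightarrow> z \<in> Units R \<longrightarrow>
        \<sigma> S (\<alpha> z) = aut_map K A R S \<alpha> (\<sigma> R z))"

definition gauge_action ::
    "('k, 'm) ring_scheme \<Rightarrow> ('v, 'e) pre_digraph \<Rightarrow>
     (('k, 'r) module \<Rightarrow> 'r \<Rightarrow>
       (('k, 'v, 'e) leavitt, 'r) tensor \<Rightarrow> (('k, 'v, 'e) leavitt, 'r) tensor) \<Rightarrow> bool" where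
  "gauge_action K E \<rho> \<longleftrightarrow>
     GL1_action K (leavitt_path_algebra K E) \<rho> \<and>
     (\<forall>R z. algebra K R \<longrightarrow> z \<in> Units R \<longrightarrow>
        (let pure = (\<lambda>x. pure_tensor K (leavitt_path_algebra K E) R (leavitt_gen K E x)) in
          (\<forall>u\<in>verts E. \<rho> R z (pure (Vertex u) \<one>\<^bsub>R\<^esub>) = pure (Vertex u) \<one>\<^bsub>R\<^esub>) \<and>
          (\<forall>f\<in>arcs E. \<rho> R z (pure (Edge f) \<one>\<^bsub>R\<^esub>) = pure (Edge f) z) \<and>
          (\<forall>f\<in>arcs E. \<rho> R z (pure (Ghost f) \<one>\<^bsub>R\<^esub>) = pure (Ghost f) (inv\<^bsub>R\<^esub> z))))"

text \<open>
  HOL cannot quantify over types within a formula, so ``every commutative algebra \<open>R\<close>'' is read as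
  ``every one whose elements lie in a fixed type''. The type below has an arbitrary type \<^typ>\<open>'u\<close>
  as a summand, so no particular algebra is excluded; the other summand guarantees that it is large
  enough for the Laurent polynomials over a ring on \<^typ>\<open>'k\<close>, whatever \<^typ>\<open>'u\<close> is.
\<close>

type_synonym ('k, 'u) universe = "(int \<Rightarrow> 'k) + 'u"

end

theory Submission
  imports Defs
begin

text \<open>
  Take \<open>R = K[t, t\<^sup>-\<^sup>1]\<close> and \<open>z = t\<close>. If \<open>a = \<Sum>\<^sub>d a\<^sub>d\<close> is a sum of homogeneous elements and \<open>\<phi> a = 0\<close>, then
  \<open>0 = \<sigma>(\<phi> a \<otimes> 1) = (\<phi> \<otimes> 1) \<rho>(a \<otimes> 1) = \<Sum>\<^sub>d \<phi> a\<^sub>d \<otimes> t\<^sup>d\<close>, and reading off coefficients gives \<open>\<phi> a\<^sub>d = 0\<close>.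
  So it suffices that a homogeneous element \<open>a\<close> of the kernel vanishes. This goes by induction on the
  length of the ghost paths in \<open>a\<close>. If there are none, \<open>a\<close> is a combination of paths of one
  length, and multiplying by ghost edges from the left reduces to multiples of vertices. Otherwise
  \<open>a f = 0\<close> for every edge \<open>f\<close> by induction, and one shows \<open>a v = 0\<close> for every vertex \<open>v\<close>: if \<open>v\<close> is
  regular, \<open>a v = \<Sum> a f f\<^sup>*\<close>; if \<open>v\<close> is a sink, \<open>a v\<close> contains no ghost edges; if \<open>v\<close> emits infinitely
  many edges, an edge \<open>g\<close> whose ghost does not occur in \<open>a\<close> shows that the ghost-free part of \<open>a v\<close>
  vanishes, and the rest is \<open>\<Sum> a f f\<^sup>*\<close> over finitely many edges.
\<close>

section \<open>Finite sums and bilinear multiplications\<close>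

context nonassoc_algebra
begin

text \<open>Zero is written as the zero scalar times zero, and the scalar is pulled out of the
  product.\<close>

lemma mult_zero_left [simp]:
  assumes "x \<in> carrier M" shows "\<zero>\<^bsub>M\<^esub> \<otimes>\<^bsub>M\<^esub> x = \<zero>\<^bsub>M\<^esub>"
  using mult_smult_left[of "\<zero>\<^bsub>R\<^esub>" "\<zero>\<^bsub>M\<^esub>" x] assms by (simp add: mult_closed)

lemma mult_zero_right [simp]:
  assumes "x \<in> carrier M" shows "x \<otimes>\<^bsub>M\<^esub> \<zero>\<^bsub>M\<^esub> = \<zero>\<^bsub>M\<^esub>"
  using mult_smult_right[of "\<zero>\<^bsub>R\<^esub>" x "\<zero>\<^bsub>M\<^esub>"] assms by (simp add: mult_closed)

lemma mult_finsum_right: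
  assumes "finite F" "g \<in> F \<rightarrow> carrier M" "y \<in> carrier M"
  shows "y \<otimes>\<^bsub>M\<^esub> finsum M g F = (\<Oplus>\<^bsub>M\<^esub>i\<in>F. y \<otimes>\<^bsub>M\<^esub> g i)"
  using assms
  by (induction F rule: finite_induct) (auto simp: mult_add_right mult_closed Pi_iff)

lemma mult_finsum_left:
  assumes "finite F" "g \<in> F \<rightarrow> carrier M" "y \<in> carrier M"
  shows "finsum M g F \<otimes>\<^bsub>M\<^esub> y = (\<Oplus>\<^bsub>M\<^esub>i\<in>F. g i \<otimes>\<^bsub>M\<^esub> y)"
  using assms
  by (induction F rule: finite_induct) (auto simp: mult_add_left mult_closed Pi_iff)

end

context abelian_monoid
begin

lemma finsum_eq_zero: "(\<And>i. i \<in> F \<Longrightarrow> g i = \<zero>) \<Longrightarrow> finsum G g F = \<zero>"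
  by (rule add.finprod_one_eqI)

lemma finsum_eq_single:
  assumes "finite F" "i \<in> F" "g i \<in> carrier G" "\<And>j. j \<in> F \<Longrightarrow> j \<noteq> i \<Longrightarrow> g j = \<zero>"
  shows "finsum G g F = g i"
proof -
  have g: "g j \<in> carrier G" if "j \<in> F" for j
    using assms(3) assms(4)[OF that] by (cases "j = i") auto
  have "finsum G g F = (\<Oplus>j\<in>F. if i = j then g j else \<zero>)"
    by (rule add.finprod_cong) (use assms g in \<open>auto simp: simp_implies_def\<close>)
  also have "\<dots> = g i"
    by (rule finsum_singleton) (use assms g in auto)
  finally show ?thesis .
qed

end

section \<open>Laurent polynomials\<close>

definition laurent_carrier :: "('k, 'm) ring_scheme \<Rightarrow> (int \<Rightarrow> 'k) set" where
  "laurent_carrier K = {f. range f \<subseteq> carrier K \<and> finite {n. f n \<noteq> \<zero>\<^bsub>K\<^esub>}}"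

definition laurent_add :: "('k, 'm) ring_scheme \<Rightarrow> (int \<Rightarrow> 'k) \<Rightarrow> (int \<Rightarrow> 'k) \<Rightarrow> int \<Rightarrow> 'k" where
  "laurent_add K f g = (\<lambda>n. f n \<oplus>\<^bsub>K\<^esub> g n)"

text \<open>Convolution, summed over the support of the left factor so that the index set is finite
  whenever \<open>f\<close> is a Laurent polynomial.\<close>

definition laurent_mult :: "('k, 'm) ring_scheme \<Rightarrow> (int \<Rightarrow> 'k) \<Rightarrow> (int \<Rightarrow> 'k) \<Rightarrow> int \<Rightarrow> 'k" where
  "laurent_mult K f g = (\<lambda>n. \<Oplus>\<^bsub>K\<^esub>i\<in>{i. f i \<noteq> \<zero>\<^bsub>K\<^esub>}. f i \<otimes>\<^bsub>K\<^esub> g (n - i))"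

definition laurent_smult :: "('k, 'm) ring_scheme \<Rightarrow> 'k \<Rightarrow> (int \<Rightarrow> 'k) \<Rightarrow> int \<Rightarrow> 'k" where
  "laurent_smult K k f = (\<lambda>n. k \<otimes>\<^bsub>K\<^esub> f n)"

definition laurent_monom :: "('k, 'm) ring_scheme \<Rightarrow> 'k \<Rightarrow> int \<Rightarrow> int \<Rightarrow> 'k" where
  "laurent_monom K k d = (\<lambda>n. if n = d then k else \<zero>\<^bsub>K\<^esub>)"

text \<open>The Laurent polynomial algebra lives in the left summand, so that it has a copy in every
  \<^typ>\<open>('k, 'u) universe\<close>.\<close>

definition laurent :: "('k, 'm) ring_scheme \<Rightarrow> ('k, (int \<Rightarrow> 'k) + 'u) module" where
  "laurent K = \<lparr>carrier = Inl ` laurent_carrier K,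
     monoid.mult = (\<lambda>x y. Inl (laurent_mult K (projl x) (projl y))),
     one = Inl (laurent_monom K \<one>\<^bsub>K\<^esub> 0),
     ring.zero = Inl (\<lambda>n. \<zero>\<^bsub>K\<^esub>),
     add = (\<lambda>x y. Inl (laurent_add K (projl x) (projl y))),
     smult = (\<lambda>k x. Inl (laurent_smult K k (projl x)))\<rparr>"

definition laurent_power :: "('k, 'm) ring_scheme \<Rightarrow> int \<Rightarrow> (int \<Rightarrow> 'k) + 'u" where
  "laurent_power K d = Inl (laurent_monom K \<one>\<^bsub>K\<^esub> d)"

lemma laurent_add_nth: "laurent_add K f g n = f n \<oplus>\<^bsub>K\<^esub> g n"
  by (simp add: laurent_add_def)

lemma laurent_smult_nth: "laurent_smult K k f n = k \<otimes>\<^bsub>K\<^esub> f n"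
  by (simp add: laurent_smult_def)

lemma laurent_monom_nth: "laurent_monom K k d n = (if n = d then k else \<zero>\<^bsub>K\<^esub>)"
  by (simp add: laurent_monom_def)

lemmas laurent_nth = laurent_add_nth laurent_smult_nth laurent_monom_nth

context cring
begin

lemma laurent_coeff_closed: "f \<in> laurent_carrier R \<Longrightarrow> f n \<in> carrier R"
  by (auto simp: laurent_carrier_def)

lemma laurent_support_finite [simp]: "f \<in> laurent_carrier R \<Longrightarrow> finite {n. f n \<noteq> \<zero>}"
  by (auto simp: laurent_carrier_def)

lemma laurent_carrierI:
  "(\<And>n. f n \<in> carrier R) \<Longrightarrow> finite S \<Longrightarrow> {n. f n \<noteq> \<zero>} \<subseteq> S \<Longrightarrow> f \<in> laurent_carrier R"
  unfolding laurent_carrier_def using finite_subset by blast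

lemma laurent_monom_closed [simp]: "k \<in> carrier R \<Longrightarrow> laurent_monom R k d \<in> laurent_carrier R"
  by (rule laurent_carrierI[of _ "{d}"]) (auto simp: laurent_monom_def)

lemma laurent_zero_closed [simp]: "(\<lambda>n. \<zero>) \<in> laurent_carrier R"
  by (rule laurent_carrierI[of _ "{}"]) auto

lemma laurent_add_closed [simp]:
  assumes "f \<in> laurent_carrier R" "g \<in> laurent_carrier R"
  shows "laurent_add R f g \<in> laurent_carrier R"
  by (rule laurent_carrierI[of _ "{n. f n \<noteq> \<zero>} \<union> {n. g n \<noteq> \<zero>}"])
    (use assms assms[THEN laurent_coeff_closed] in \<open>auto simp: laurent_nth\<close>)

lemma laurent_smult_closed [simp]:
  assumes "k \<in> carrier R" "f \<in> laurent_carrier R"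
  shows "laurent_smult R k f \<in> laurent_carrier R"
  by (rule laurent_carrierI[of _ "{n. f n \<noteq> \<zero>}"])
    (use assms assms(2)[THEN laurent_coeff_closed] in \<open>auto simp: laurent_nth\<close>)

text \<open>The index set may be enlarged by zero terms, so products with different left factors can
  be compared over one common finite set.\<close>

lemma laurent_mult_coeff:
  assumes "finite S" "{i. f i \<noteq> \<zero>} \<subseteq> S" "f \<in> laurent_carrier R" "g \<in> laurent_carrier R"
  shows "laurent_mult R f g n = (\<Oplus>i\<in>S. f i \<otimes> g (n - i))"
  unfolding laurent_mult_def
  by (rule add.finprod_mono_neutral_cong_left) (use assms assms(3,4)[THEN laurent_coeff_closed] in auto)

lemma laurent_mult_closed [simp]:
  assumes f: "f \<in> laurent_carrier R" and g: "g \<in> laurent_carrier R"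
  shows "laurent_mult R f g \<in> laurent_carrier R"
proof (rule laurent_carrierI)
  \<comment> \<open>The support of a product lies in the sumset of the two supports.\<close>
  let ?S = "(\<lambda>(i, j). i + j) ` ({n. f n \<noteq> \<zero>} \<times> {n. g n \<noteq> \<zero>})"
  show "finite ?S" using f g by simp
  show "laurent_mult R f g n \<in> carrier R" for n
    unfolding laurent_mult_def by (rule finsum_closed) (use f g f[THEN laurent_coeff_closed] g[THEN laurent_coeff_closed] in auto)
  show "{n. laurent_mult R f g n \<noteq> \<zero>} \<subseteq> ?S"
  proof (rule subsetI, rule ccontr)
    fix n assume n: "n \<in> {n. laurent_mult R f g n \<noteq> \<zero>}" "n \<notin> ?S"
    have "f i \<otimes> g (n - i) = \<zero>" if "f i \<noteq> \<zero>" for i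
    proof (cases "g (n - i) = \<zero>")
      case False
      then have "n \<in> ?S" using that by (intro image_eqI[of _ _ "(i, n - i)"]) auto
      with n show ?thesis by simp
    qed (use f[THEN laurent_coeff_closed] in simp)
    then have "laurent_mult R f g n = \<zero>"
      unfolding laurent_mult_def by (intro finsum_eq_zero) auto
    with n show False by simp
  qed
qed

lemma laurent_mult_add_left:
  assumes f: "f \<in> laurent_carrier R" and g: "g \<in> laurent_carrier R" and h: "h \<in> laurent_carrier R"
  shows "laurent_mult R (laurent_add R f g) h = laurent_add R (laurent_mult R f h) (laurent_mult R g h)"
proof
  fix n
  note cl [simp] = f[THEN laurent_coeff_closed] g[THEN laurent_coeff_closed] h[THEN laurent_coeff_closed]
  let ?S = "{n. f n \<noteq> \<zero>} \<union> {n. g n \<noteq> \<zero>}"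
  have "laurent_mult R (laurent_add R f g) h n = (\<Oplus>i\<in>?S. laurent_add R f g i \<otimes> h (n - i))"
    by (rule laurent_mult_coeff) (use f g h in \<open>auto simp: laurent_nth\<close>)
  also have "\<dots> = (\<Oplus>i\<in>?S. f i \<otimes> h (n - i) \<oplus> g i \<otimes> h (n - i))"
    using f g h by (simp add: laurent_nth l_distr)
  also have "\<dots> = (\<Oplus>i\<in>?S. f i \<otimes> h (n - i)) \<oplus> (\<Oplus>i\<in>?S. g i \<otimes> h (n - i))"
    by (rule finsum_addf) (use f g h in auto)
  also have "\<dots> = laurent_add R (laurent_mult R f h) (laurent_mult R g h) n"
    unfolding laurent_add_nth using f g h
    by (subst (1 2) laurent_mult_coeff[of ?S]) auto
  finally show "laurent_mult R (laurent_add R f g) h n = \<dots>" .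
qed

lemma laurent_mult_add_right:
  assumes f: "f \<in> laurent_carrier R" and g: "g \<in> laurent_carrier R" and h: "h \<in> laurent_carrier R"
  shows "laurent_mult R h (laurent_add R f g) = laurent_add R (laurent_mult R h f) (laurent_mult R h g)"
proof
  fix n
  note cl [simp] = f[THEN laurent_coeff_closed] g[THEN laurent_coeff_closed] h[THEN laurent_coeff_closed]
  let ?S = "{n. h n \<noteq> \<zero>}"
  have "laurent_mult R h (laurent_add R f g) n = (\<Oplus>i\<in>?S. h i \<otimes> f (n - i) \<oplus> h i \<otimes> g (n - i))"
    using f g h by (simp add: laurent_mult_def laurent_nth r_distr)
  also have "\<dots> = (\<Oplus>i\<in>?S. h i \<otimes> f (n - i)) \<oplus> (\<Oplus>i\<in>?S. h i \<otimes> g (n - i))"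
    by (rule finsum_addf) (use f g h in auto)
  finally show "laurent_mult R h (laurent_add R f g) n
      = laurent_add R (laurent_mult R h f) (laurent_mult R h g) n"
    by (simp add: laurent_add_def laurent_mult_def)
qed

lemma laurent_mult_smult_left:
  assumes k: "k \<in> carrier R" and f: "f \<in> laurent_carrier R" and g: "g \<in> laurent_carrier R"
  shows "laurent_mult R (laurent_smult R k f) g = laurent_smult R k (laurent_mult R f g)"
proof
  fix n
  note cl [simp] = f[THEN laurent_coeff_closed] g[THEN laurent_coeff_closed]
  let ?S = "{n. f n \<noteq> \<zero>}"
  have "laurent_mult R (laurent_smult R k f) g n = (\<Oplus>i\<in>?S. laurent_smult R k f i \<otimes> g (n - i))"
    by (rule laurent_mult_coeff) (use k f g in \<open>auto simp: laurent_nth\<close>)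
  also have "\<dots> = (\<Oplus>i\<in>?S. k \<otimes> (f i \<otimes> g (n - i)))"
    using k f g by (simp add: laurent_nth m_assoc)
  also have "\<dots> = k \<otimes> (\<Oplus>i\<in>?S. f i \<otimes> g (n - i))"
    by (rule finsum_rdistr[symmetric]) (use k f g in auto)
  finally show "laurent_mult R (laurent_smult R k f) g n = laurent_smult R k (laurent_mult R f g) n"
    by (simp add: laurent_smult_def laurent_mult_def)
qed

lemma laurent_mult_monom:
  assumes "k \<in> carrier R" "g \<in> laurent_carrier R"
  shows "laurent_mult R (laurent_monom R k d) g = (\<lambda>n. k \<otimes> g (n - d))"
proof
  fix n
  note assms(2)[THEN laurent_coeff_closed, simp]
  have "{i. laurent_monom R k d i \<noteq> \<zero>} \<subseteq> {d}"
    by (auto simp: laurent_nth)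
  then have "laurent_mult R (laurent_monom R k d) g n = (\<Oplus>i\<in>{d}. laurent_monom R k d i \<otimes> g (n - i))"
    using assms by (intro laurent_mult_coeff) simp_all
  also have "\<dots> = k \<otimes> g (n - d)"
    using assms by (simp add: laurent_nth)
  finally show "laurent_mult R (laurent_monom R k d) g n = k \<otimes> g (n - d)" .
qed

lemma laurent_monom_mult_monom:
  assumes "k \<in> carrier R" "l \<in> carrier R"
  shows "laurent_mult R (laurent_monom R k d) (laurent_monom R l e) = laurent_monom R (k \<otimes> l) (d + e)"
  unfolding laurent_mult_monom[OF assms(1) laurent_monom_closed[OF assms(2)]]
  using assms by (auto simp: fun_eq_iff laurent_nth)

text \<open>Identities that are additive in each argument need only be checked on monomials, where
  no double sums occur.\<close>

lemma laurent_induct [consumes 1, case_names monom add]: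
  assumes "f \<in> laurent_carrier R"
    and monom: "\<And>k d. k \<in> carrier R \<Longrightarrow> P (laurent_monom R k d)"
    and add: "\<And>f g. \<lbrakk>f \<in> laurent_carrier R; g \<in> laurent_carrier R; P f; P g\<rbrakk> \<Longrightarrow> P (laurent_add R f g)"
  shows "P f"
proof -
  have "finite S \<Longrightarrow> f \<in> laurent_carrier R \<Longrightarrow> {n. f n \<noteq> \<zero>} \<subseteq> S \<Longrightarrow> P f" for S
  proof (induction S arbitrary: f rule: finite_induct)
    case empty
    \<comment> \<open>The zero polynomial is the monomial with coefficient zero, which is why the
      principle has no case for zero.\<close>
    then have "f = laurent_monom R \<zero> 0" by (auto simp: laurent_monom_def)
    then show ?case using monom[of \<zero> 0] by simp
  next
    case (insert d S)
    \<comment> \<open>Deleting the coefficient at \<open>d\<close> leaves support in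
      \<open>S\<close>, and the deleted term is a monomial.\<close>
    define g where "g = f(d := \<zero>)"
    have g: "g \<in> laurent_carrier R"
      by (rule laurent_carrierI[of _ S]) (use insert laurent_coeff_closed[OF insert.prems(1)] in \<open>auto simp: g_def\<close>)
    have "P g" by (rule insert.IH[OF g]) (use insert in \<open>auto simp: g_def\<close>)
    moreover have "f = laurent_add R (laurent_monom R (f d) d) g"
      using laurent_coeff_closed[OF insert.prems(1)] by (auto simp: fun_eq_iff laurent_nth g_def)
    moreover have "f d \<in> carrier R" using insert.prems by (simp add: laurent_coeff_closed)
    ultimately show ?case
      using add[of "laurent_monom R (f d) d" g] monom[of "f d" d] g by (metis laurent_monom_closed)
  qed
  from this[of "{n. f n \<noteq> \<zero>}"] show ?thesis using assms(1) by simp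
qed

text \<open>Both sides are additive in each factor, which reduces the claim to monomials; there the
  coefficients commute in \<open>R\<close> and the exponents in the integers.\<close>

lemma laurent_mult_comm:
  assumes f: "f \<in> laurent_carrier R" and g: "g \<in> laurent_carrier R"
  shows "laurent_mult R f g = laurent_mult R g f"
  using f
proof (induction f rule: laurent_induct)
  case (monom k d)
  from g show ?case
  proof (induction g rule: laurent_induct)
    case (monom l e)
    then show ?case using \<open>k \<in> carrier R\<close> by (simp add: laurent_monom_mult_monom m_comm algebra_simps)
  qed (use monom in \<open>simp add: laurent_mult_add_left laurent_mult_add_right\<close>)
qed (use g in \<open>simp add: laurent_mult_add_left laurent_mult_add_right\<close>)

lemma laurent_mult_assoc:
  assumes f: "f \<in> laurent_carrier R" and g: "g \<in> laurent_carrier R" and h: "h \<in> laurent_carrier R"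
  shows "laurent_mult R (laurent_mult R f g) h = laurent_mult R f (laurent_mult R g h)"
  using f
proof (induction f rule: laurent_induct)
  case (monom k d)
  note k = monom
  from g show ?case
  proof (induction g rule: laurent_induct)
    case (monom l e)
    note l = monom
    from h show ?case
    proof (induction h rule: laurent_induct)
      case (monom r a)
      then show ?case using k l by (simp add: laurent_monom_mult_monom m_assoc algebra_simps)
    qed (use k l in \<open>simp add: laurent_mult_add_right\<close>)
  qed (use k h in \<open>simp add: laurent_mult_add_left laurent_mult_add_right\<close>)
qed (use g h in \<open>simp add: laurent_mult_add_left\<close>)

lemma laurent_add_assoc:
  assumes "f \<in> laurent_carrier R" "g \<in> laurent_carrier R" "h \<in> laurent_carrier R"
  shows "laurent_add R (laurent_add R f g) h = laurent_add R f (laurent_add R g h)"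
  using assms[THEN laurent_coeff_closed] by (simp add: fun_eq_iff laurent_nth a_assoc)

lemma laurent_add_comm:
  assumes "f \<in> laurent_carrier R" "g \<in> laurent_carrier R"
  shows "laurent_add R f g = laurent_add R g f"
  using assms[THEN laurent_coeff_closed] by (simp add: fun_eq_iff laurent_nth a_comm)

lemma laurent_add_zero: "f \<in> laurent_carrier R \<Longrightarrow> laurent_add R (\<lambda>n. \<zero>) f = f"
  using laurent_coeff_closed[of f] by (simp add: fun_eq_iff laurent_nth)

section \<open>The commutative algebra of Laurent polynomials and its monomial units\<close>

lemma laurent_abelian_group: "abelian_group (laurent R)"
proof (rule abelian_groupI)
  fix x :: "(int \<Rightarrow> 'a) + 'c" assume "x \<in> carrier (laurent R)"
  then obtain f where f: "x = Inl f" "f \<in> laurent_carrier R" by (auto simp: laurent_def)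
  note cl [simp] = laurent_coeff_closed[OF f(2)]
  have "(\<lambda>n. \<ominus> f n) \<in> laurent_carrier R"
    by (rule laurent_carrierI[of _ "{n. f n \<noteq> \<zero>}"]) (use f in auto)
  moreover have "laurent_add R (\<lambda>n. \<ominus> f n) f = (\<lambda>n. \<zero>)"
    by (simp add: fun_eq_iff laurent_nth l_neg)
  ultimately show "\<exists>y\<in>carrier (laurent R). y \<oplus>\<^bsub>laurent R\<^esub> x = \<zero>\<^bsub>laurent R\<^esub>"
    using f by (intro bexI[of _ "Inl (\<lambda>n. \<ominus> f n)"]) (auto simp: laurent_def)
qed (auto simp: laurent_def laurent_add_assoc laurent_add_zero intro: laurent_add_comm)

lemma laurent_one_mult: "f \<in> laurent_carrier R \<Longrightarrow> laurent_mult R (laurent_monom R \<one> 0) f = f"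
  using laurent_coeff_closed[of f] by (simp add: laurent_mult_monom)

lemma laurent_comm_monoid: "Group.comm_monoid (laurent R)"
  by (rule comm_monoidI) (auto simp: laurent_def laurent_mult_assoc laurent_one_mult intro: laurent_mult_comm)

lemma laurent_smult_laws:
  assumes "f \<in> laurent_carrier R" "g \<in> laurent_carrier R" "k \<in> carrier R" "l \<in> carrier R"
  shows "laurent_smult R (k \<oplus> l) f = laurent_add R (laurent_smult R k f) (laurent_smult R l f)"
    and "laurent_smult R k (laurent_add R f g) = laurent_add R (laurent_smult R k f) (laurent_smult R k g)"
    and "laurent_smult R (k \<otimes> l) f = laurent_smult R k (laurent_smult R l f)"
  using assms(3,4) assms(1,2)[THEN laurent_coeff_closed] by (simp_all add: fun_eq_iff laurent_nth l_distr r_distr m_assoc)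

lemma laurent_smult_one: "f \<in> laurent_carrier R \<Longrightarrow> laurent_smult R \<one> f = f"
  using laurent_coeff_closed[of f] by (simp add: fun_eq_iff laurent_nth)

lemma laurent_algebra: "algebra R (laurent R)"
proof (rule algebraI)
  show "cring R" by (rule is_cring)
  show "cring (laurent R)"
    by (rule cringI[OF laurent_abelian_group laurent_comm_monoid])
      (auto simp: laurent_def laurent_mult_add_left)
qed (auto simp: laurent_def laurent_mult_smult_left laurent_smult_laws laurent_smult_one)

lemma laurent_power_closed [simp]: "laurent_power R d \<in> carrier (laurent R)"
  by (auto simp: laurent_power_def laurent_def)

lemma laurent_power_mult [simp]:
  "laurent_power R d \<otimes>\<^bsub>laurent R\<^esub> laurent_power R e = laurent_power R (d + e)"
  by (auto simp: laurent_power_def laurent_def laurent_monom_mult_monom)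

lemma laurent_power_0: "laurent_power R 0 = \<one>\<^bsub>laurent R\<^esub>"
  by (simp add: laurent_power_def laurent_def)

lemma laurent_power_Units: "laurent_power R d \<in> Units (laurent R)"
  unfolding Units_def
  by (auto simp: laurent_power_0 intro!: bexI[of _ "laurent_power R (- d)"])

lemma laurent_power_inv: "inv\<^bsub>laurent R\<^esub> (laurent_power R d) = laurent_power R (- d)"
proof -
  interpret L: algebra R "laurent R" by (rule laurent_algebra)
  show ?thesis
    by (rule L.comm_inv_char) (auto simp: laurent_power_0)
qed

end

section \<open>Scalar extensions\<close>

text \<open>Additivity in the function argument. The product of formal sums is a nested
  \<open>frag_extend\<close>, and its right factor enters through that function.\<close>

lemma frag_extend_diff_fun:
  fixes f g :: "'a \<Rightarrow> 'b \<Rightarrow>\<^sub>0 int"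
  shows "frag_extend (\<lambda>i. f i - g i) x = frag_extend f x - frag_extend g x"
proof -
  have "frag_cmul c (a - b) = frag_cmul c a - frag_cmul c b" for c and a b :: "'b \<Rightarrow>\<^sub>0 int"
    by (rule poly_mapping_eqI) (simp add: lookup_minus right_diff_distrib)
  then show ?thesis
    by (simp add: frag_extend_def sum_subtractf[symmetric])
qed

lemma tensor_relators_cases [consumes 1, case_names left right balanced]:
  assumes "x \<in> tensor_relators K A R"
  obtains a b r where "x = frag_of (a \<oplus>\<^bsub>A\<^esub> b, r) - frag_of (a, r) - frag_of (b, r)"
      "a \<in> carrier A" "b \<in> carrier A" "r \<in> carrier R"
    | a r s where "x = frag_of (a, r \<oplus>\<^bsub>R\<^esub> s) - frag_of (a, r) - frag_of (a, s)"
      "a \<in> carrier A" "r \<in> carrier R" "s \<in> carrier R"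
    | k a r where "x = frag_of (k \<odot>\<^bsub>A\<^esub> a, r) - frag_of (a, k \<odot>\<^bsub>R\<^esub> r)"
      "k \<in> carrier K" "a \<in> carrier A" "r \<in> carrier R"
  using assms unfolding tensor_relators_def by blast

lemma tensor_relators_left:
    "\<lbrakk>a \<in> carrier A; b \<in> carrier A; r \<in> carrier R\<rbrakk> \<Longrightarrow>
      frag_of (a \<oplus>\<^bsub>A\<^esub> b, r) - frag_of (a, r) - frag_of (b, r) \<in> tensor_relators K A R"
  and tensor_relators_right:
    "\<lbrakk>a \<in> carrier A; r \<in> carrier R; s \<in> carrier R\<rbrakk> \<Longrightarrow>
      frag_of (a, r \<oplus>\<^bsub>R\<^esub> s) - frag_of (a, r) - frag_of (a, s) \<in> tensor_relators K A R"
  and tensor_relators_balanced: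
    "\<lbrakk>k \<in> carrier K; a \<in> carrier A; r \<in> carrier R\<rbrakk> \<Longrightarrow>
      frag_of (k \<odot>\<^bsub>A\<^esub> a, r) - frag_of (a, k \<odot>\<^bsub>R\<^esub> r) \<in> tensor_relators K A R"
  unfolding tensor_relators_def by blast+

lemmas tensor_relators_intros = tensor_relators_left tensor_relators_right tensor_relators_balanced

locale scalar_extension = A: nonassoc_algebra K A + R: algebra K R
  for K :: "('k, 'm) ring_scheme" and A :: "('k, 'a) module" and R :: "('k, 'r) module"
begin

abbreviation "pairs \<equiv> carrier A \<times> carrier R"
abbreviation "null \<equiv> tensor_null K A R"
abbreviation "cls \<equiv> tensor_class K A R"
abbreviation "T \<equiv> tensor_algebra K A R"

section \<open>The subgroup of tensor relations\<close>

lemma relators_keys: "x \<in> tensor_relators K A R \<Longrightarrow> Poly_Mapping.keys x \<subseteq> pairs"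
  unfolding tensor_relators_def
  by (auto simp: keys_frag_of dest!: subsetD[OF keys_diff])

lemma null_subgroup: "subgroup null (free_Abelian_group pairs)"
  unfolding tensor_null_def
  by (rule group.generate_is_subgroup) (use relators_keys in auto)

lemma null_zero [simp]: "0 \<in> null"
  using subgroup.one_closed[OF null_subgroup] by simp

lemma null_keys: "x \<in> null \<Longrightarrow> Poly_Mapping.keys x \<subseteq> pairs"
  using subgroup.mem_carrier[OF null_subgroup] by simp

lemma null_add: "x \<in> null \<Longrightarrow> y \<in> null \<Longrightarrow> x + y \<in> null"
  using subgroup.m_closed[OF null_subgroup] by simp

lemma null_minus: "x \<in> null \<Longrightarrow> - x \<in> null"
  using subgroup.m_inv_closed[OF null_subgroup] null_keys by force

lemma null_diff: "x \<in> null \<Longrightarrow> y \<in> null \<Longrightarrow> x - y \<in> null"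
  using null_add[of x "- y"] null_minus[of y] by simp

lemma relators_null: "x \<in> tensor_relators K A R \<Longrightarrow> x \<in> null"
  unfolding tensor_null_def by (rule generate.incl)

text \<open>Tailored to additive maps: once sums and negatives are respected, only the relators
  remain to be checked.\<close>

lemma null_induct [consumes 1, case_names zero relator add minus]:
  assumes "x \<in> null" and zero: "P 0" and rel: "\<And>x. x \<in> tensor_relators K A R \<Longrightarrow> P x"
    and add: "\<And>x y. \<lbrakk>x \<in> null; y \<in> null; P x; P y\<rbrakk> \<Longrightarrow> P (x + y)"
    and minus: "\<And>x. \<lbrakk>x \<in> null; P x\<rbrakk> \<Longrightarrow> P (- x)"
  shows "P x"
  using assms(1) unfolding tensor_null_def
proof (induction rule: generate.induct)
  case (inv h)
  then show ?case
    using minus[OF relators_null rel] relators_keys[of h] by simp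
next
  case (eng h1 h2)
  then show ?case using add[of h1 h2] by (simp add: tensor_null_def)
qed (use zero rel in auto)

section \<open>Classes of formal sums and their operations\<close>

lemma class_eq: "cls x = {h + x | h. h \<in> null}"
  by (auto simp: tensor_class_def a_r_coset_def' tensor_pre_def)

lemma class_self: "x \<in> cls x"
  unfolding class_eq using null_zero by force

lemma class_eqI:
  assumes "x - y \<in> null"
  shows "cls x = cls y"
proof -
  \<comment> \<open>One inclusion for arbitrary arguments suffices, since the relations are closed
    under negation.\<close>
  have *: "cls x \<subseteq> cls y" if "x - y \<in> null" for x y
  proof
    fix z assume "z \<in> cls x"
    then obtain h where h: "h \<in> null" "z = h + x" by (auto simp: class_eq)
    then have "z = (h + (x - y)) + y" by simp
    then show "z \<in> cls y" unfolding class_eq using null_add[OF h(1) that] by blast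
  qed
  show ?thesis
    using *[OF assms] *[of y x] null_minus[OF assms] by auto
qed

lemma class_eqD: "cls x = cls y \<Longrightarrow> x - y \<in> null"
  using class_self[of x] by (auto simp: class_eq[of y])

lemma class_mem: "y \<in> cls x \<Longrightarrow> y - x \<in> null"
  by (auto simp: class_eq)

lemma class_closed: "Poly_Mapping.keys x \<subseteq> pairs \<Longrightarrow> cls x \<in> carrier T"
  by (auto simp: tensor_algebra_def A_RCOSETS_def' tensor_class_def tensor_pre_def)

lemma class_add: "cls x \<oplus>\<^bsub>T\<^esub> cls y = cls (x + y)"
proof -
  have "cls x \<oplus>\<^bsub>T\<^esub> cls y = {h + k | h k. h \<in> cls x \<and> k \<in> cls y}"
    by (auto simp: tensor_algebra_def set_add_def' tensor_pre_def)
  also have "\<dots> = cls (x + y)"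
  proof (intro equalityI subsetI)
    fix z assume "z \<in> {h + k | h k. h \<in> cls x \<and> k \<in> cls y}"
    then obtain a b where "a \<in> null" "b \<in> null" "z = (a + x) + (b + y)"
      by (auto simp: class_eq)
    then have "a + b \<in> null" "z = (a + b) + (x + y)" using null_add by auto
    then show "z \<in> cls (x + y)" unfolding class_eq by blast
  next
    fix z assume "z \<in> cls (x + y)"
    then obtain a where "a \<in> null" "z = (a + x) + y" by (auto simp: class_eq)
    moreover from this have "a + x \<in> cls x" unfolding class_eq by blast
    ultimately show "z \<in> {h + k | h k. h \<in> cls x \<and> k \<in> cls y}"
      using class_self[of y] by blast
  qed
  finally show ?thesis .
qed

lemma class_UN:
  assumes "\<And>y. y \<in> cls x \<Longrightarrow> f y = C"
  shows "(\<Union>y\<in>cls x. f y) = C"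
  using assms class_self[of x] by auto

abbreviation "pmult \<equiv> monoid.mult (tensor_pre A R)"

lemma pmult_of: "pmult (frag_of (a, r)) (frag_of (b, s)) = frag_of (a \<otimes>\<^bsub>A\<^esub> b, r \<otimes>\<^bsub>R\<^esub> s)"
  by (simp add: tensor_pre_def)

lemma pmult_diff_left: "pmult (x - y) z = pmult x z - pmult y z"
  by (simp add: tensor_pre_def frag_extend_diff)

lemma pmult_diff_right: "pmult z (x - y) = pmult z x - pmult z y"
  by (simp add: tensor_pre_def frag_extend_diff case_prod_unfold frag_extend_diff_fun)

lemma pmult_zero [simp]: "pmult 0 x = 0" "pmult x 0 = 0"
  using pmult_diff_left[of x x x] pmult_diff_right[of x x x] pmult_diff_left[of 0 0 x] by auto

lemma pmult_minus: "pmult (- x) y = - pmult x y" "pmult x (- y) = - pmult x y"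
  using pmult_diff_left[of 0 x y] pmult_diff_right[of x 0 y] by auto

lemma pmult_add: "pmult (x + y) z = pmult x z + pmult y z" "pmult z (x + y) = pmult z x + pmult z y"
  using pmult_diff_left[of x "- y" z] pmult_diff_right[of z x "- y"] by (auto simp: pmult_minus)

text \<open>A relator times a generator is again a relator of the same kind, by distributivity in
  \<open>A\<close> and \<open>R\<close> and because scalars pass through both products.\<close>

lemma pmult_relator_of:
  assumes "x \<in> tensor_relators K A R" "a \<in> carrier A" "r \<in> carrier R"
  shows "pmult x (frag_of (a, r)) \<in> null" "pmult (frag_of (a, r)) x \<in> null"
proof -
  have "pmult x (frag_of (a, r)) \<in> tensor_relators K A R"
    using assms(1)
  proof (cases rule: tensor_relators_cases)
    case (balanced k b s)
    then show ?thesis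
      using assms(2,3) tensor_relators_balanced[of k K "b \<otimes>\<^bsub>A\<^esub> a" A "s \<otimes>\<^bsub>R\<^esub> r" R]
      by (simp add: pmult_of pmult_diff_left A.mult_closed A.mult_smult_left R.smult_assoc2)
  qed (use assms(2,3) in \<open>auto simp: pmult_of pmult_diff_left A.mult_add_left A.mult_closed R.l_distr
        intro!: tensor_relators_left tensor_relators_right\<close>)
  then show "pmult x (frag_of (a, r)) \<in> null" by (rule relators_null)
  have "pmult (frag_of (a, r)) x \<in> tensor_relators K A R"
    using assms(1)
  proof (cases rule: tensor_relators_cases)
    case (balanced k b s)
    \<comment> \<open>Commutativity of \<open>R\<close> moves the scalar past the left
      factor.\<close>
    have "r \<otimes>\<^bsub>R\<^esub> (k \<odot>\<^bsub>R\<^esub> s) = k \<odot>\<^bsub>R\<^esub> (r \<otimes>\<^bsub>R\<^esub> s)"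
      using balanced assms(3) by (simp add: R.smult_assoc2 R.m_comm[of r])
    with balanced show ?thesis
      using assms(2,3) tensor_relators_balanced[of k K "a \<otimes>\<^bsub>A\<^esub> b" A "r \<otimes>\<^bsub>R\<^esub> s" R]
      by (simp add: pmult_of pmult_diff_right A.mult_closed A.mult_smult_right)
  qed (use assms(2,3) in \<open>auto simp: pmult_of pmult_diff_right A.mult_add_right A.mult_closed R.r_distr
        intro!: tensor_relators_left tensor_relators_right\<close>)
  then show "pmult (frag_of (a, r)) x \<in> null" by (rule relators_null)
qed

text \<open>The relations form a two-sided ideal of the formal sums, which makes the product of
  classes independent of representatives. The first induction fixes a generator and runs over the
  relations, the second runs over the formal sum.\<close>

lemma pmult_null:
  assumes "x \<in> null" "Poly_Mapping.keys y \<subseteq> pairs"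
  shows "pmult x y \<in> null" "pmult y x \<in> null"
proof -
  have of: "pmult x (frag_of p) \<in> null \<and> pmult (frag_of p) x \<in> null" if "p \<in> pairs" for p
    using assms(1)
  proof (induction rule: null_induct)
    case (relator x)
    then show ?case using that pmult_relator_of by auto
  qed (auto simp: pmult_add pmult_minus intro: null_add null_minus)
  show "pmult x y \<in> null"
    by (rule free_Abelian_group_induct[OF assms(2)]) (use of in \<open>auto simp: pmult_diff_right intro: null_diff\<close>)
  show "pmult y x \<in> null"
    by (rule free_Abelian_group_induct[OF assms(2)]) (use of in \<open>auto simp: pmult_diff_left intro: null_diff\<close>)
qed

lemma class_mult:
  assumes x: "Poly_Mapping.keys x \<subseteq> pairs" and y: "Poly_Mapping.keys y \<subseteq> pairs"
  shows "cls x \<otimes>\<^bsub>T\<^esub> cls y = cls (pmult x y)"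
proof -
  have "cls (pmult x' y') = cls (pmult x y)" if "x' \<in> cls x" "y' \<in> cls y" for x' y'
  proof (rule class_eqI)
    have y': "Poly_Mapping.keys y' \<subseteq> pairs"
      using keys_add[of "y' - y" y] null_keys[OF class_mem[OF that(2)]] y by simp blast
    \<comment> \<open>The usual splitting: each summand has one factor among the relations.\<close>
    have "pmult x' y' - pmult x y = pmult (x' - x) y' + pmult x (y' - y)"
      by (simp add: pmult_diff_left pmult_diff_right)
    then show "pmult x' y' - pmult x y \<in> null"
      using pmult_null(1)[OF class_mem[OF that(1)] y'] pmult_null(2)[OF class_mem[OF that(2)] x] null_add
      by simp
  qed
  then have "(\<Union>x'\<in>cls x. \<Union>y'\<in>cls y. cls (pmult x' y')) = cls (pmult x y)"
    by (intro class_UN) auto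
  then show ?thesis
    by (simp add: tensor_algebra_def rcoset_mult_def tensor_class_def)
qed

text \<open>An additive map that preserves the relations takes all representatives of a class into
  one class, so the union over them is that class.\<close>

lemma class_UN_null:
  assumes "\<And>y. y \<in> null \<Longrightarrow> frag_extend b y \<in> null"
  shows "(\<Union>y\<in>cls x. cls (frag_extend b y)) = cls (frag_extend b x)"
  using assms class_mem by (intro class_UN class_eqI) (auto simp: frag_extend_diff[symmetric])

lemma class_smult:
  assumes r: "r \<in> carrier R"
  shows "r \<odot>\<^bsub>T\<^esub> cls x = cls (frag_extend (\<lambda>(a, s). frag_of (a, r \<otimes>\<^bsub>R\<^esub> s)) x)"
proof -
  have "frag_extend (\<lambda>(a, s). frag_of (a, r \<otimes>\<^bsub>R\<^esub> s)) y \<in> null" if "y \<in> null" for y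
    using that
  proof (induction rule: null_induct)
    case (relator y)
    have "frag_extend (\<lambda>(a, s). frag_of (a, r \<otimes>\<^bsub>R\<^esub> s)) y \<in> tensor_relators K A R"
      using relator
    proof (cases rule: tensor_relators_cases)
      case (balanced k a s)
      have "r \<otimes>\<^bsub>R\<^esub> (k \<odot>\<^bsub>R\<^esub> s) = k \<odot>\<^bsub>R\<^esub> (r \<otimes>\<^bsub>R\<^esub> s)"
        using balanced r by (simp add: R.smult_assoc2 R.m_comm[of r])
      with balanced r show ?thesis
        by (auto simp: frag_extend_diff intro!: tensor_relators_balanced)
    qed (use r in \<open>auto simp: frag_extend_diff R.r_distr intro!: tensor_relators_left tensor_relators_right\<close>)
    then show ?case by (rule relators_null)
  qed (auto simp: frag_extend_add frag_extend_minus intro: null_add null_minus)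
  then show ?thesis
    by (simp add: tensor_algebra_def class_UN_null)
qed

section \<open>Calculation with pure tensors\<close>

abbreviation "pure \<equiv> pure_tensor K A R"

lemma pure_closed: "\<lbrakk>a \<in> carrier A; r \<in> carrier R\<rbrakk> \<Longrightarrow> pure a r \<in> carrier T"
  unfolding pure_tensor_def by (rule class_closed) (simp add: keys_frag_of)

lemma pure_add_left:
  "\<lbrakk>a \<in> carrier A; b \<in> carrier A; r \<in> carrier R\<rbrakk> \<Longrightarrow> pure (a \<oplus>\<^bsub>A\<^esub> b) r = pure a r \<oplus>\<^bsub>T\<^esub> pure b r"
  unfolding pure_tensor_def class_add
  by (rule class_eqI, rule relators_null) (auto simp: tensor_relators_def diff_diff_eq[symmetric])

lemma pure_mult:
  "\<lbrakk>a \<in> carrier A; b \<in> carrier A; r \<in> carrier R; s \<in> carrier R\<rbrakk> \<Longrightarrow>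
    pure a r \<otimes>\<^bsub>T\<^esub> pure b s = pure (a \<otimes>\<^bsub>A\<^esub> b) (r \<otimes>\<^bsub>R\<^esub> s)"
  unfolding pure_tensor_def by (subst class_mult) (auto simp: keys_frag_of pmult_of)

lemma pure_smult:
  "\<lbrakk>a \<in> carrier A; r \<in> carrier R; s \<in> carrier R\<rbrakk> \<Longrightarrow> r \<odot>\<^bsub>T\<^esub> pure a s = pure a (r \<otimes>\<^bsub>R\<^esub> s)"
  unfolding pure_tensor_def by (simp add: class_smult)

lemma pure_balanced:
  "\<lbrakk>k \<in> carrier K; a \<in> carrier A; r \<in> carrier R\<rbrakk> \<Longrightarrow> pure (k \<odot>\<^bsub>A\<^esub> a) r = pure a (k \<odot>\<^bsub>R\<^esub> r)"
  unfolding pure_tensor_def by (rule class_eqI, rule relators_null) (auto simp: tensor_relators_def)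

text \<open>The additivity relator for zero plus zero collapses to the negative of the generator
  \<open>(\<zero>, r)\<close>.\<close>

lemma pure_zero: "r \<in> carrier R \<Longrightarrow> pure \<zero>\<^bsub>A\<^esub> r = cls 0"
  using relators_null[OF tensor_relators_left[of "\<zero>\<^bsub>A\<^esub>" A "\<zero>\<^bsub>A\<^esub>" r R K]]
    null_minus[of "- frag_of (\<zero>\<^bsub>A\<^esub>, r)"]
  unfolding pure_tensor_def by (intro class_eqI) simp

text \<open>The sum is kept as the class of a single formal sum, the form from which coefficients
  are later extracted.\<close>

lemma pure_finsum:
  assumes "finite D" "b \<in> D \<rightarrow> carrier A" "r \<in> carrier R"
  shows "pure (finsum A b D) r = cls (\<Sum>d\<in>D. frag_of (b d, r))"
  using assms
proof (induction D rule: finite_induct)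
  case (insert d D)
  then have "pure (finsum A b (insert d D)) r = pure (b d \<oplus>\<^bsub>A\<^esub> finsum A b D) r"
    by (subst A.finsum_insert) auto
  also have "\<dots> = pure (b d) r \<oplus>\<^bsub>T\<^esub> pure (finsum A b D) r"
    by (rule pure_add_left) (use insert in auto)
  finally have "pure (finsum A b (insert d D)) r = pure (b d) r \<oplus>\<^bsub>T\<^esub> pure (finsum A b D) r" .
  with insert show ?case
    by (simp add: pure_tensor_def class_add)
qed (simp add: pure_zero)

section \<open>Endomorphisms on formal sums and extraction of coefficients\<close>

text \<open>The image of zero is some class \<open>cls y\<close> with
  \<open>cls y = cls (y + y)\<close>, so \<open>y\<close> itself is a relation.\<close>

lemma additive_class_zero:
  assumes "h \<in> alg_hom S T T"
  shows "h (cls 0) = cls 0"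
proof -
  have T: "cls 0 \<in> carrier T" by (rule class_closed) simp
  then have "h (cls 0) \<in> carrier T"
    and add: "h (cls 0 \<oplus>\<^bsub>T\<^esub> cls 0) = h (cls 0) \<oplus>\<^bsub>T\<^esub> h (cls 0)"
    using assms by (auto simp: alg_hom_def)
  then obtain y where y: "h (cls 0) = cls y"
    by (auto simp: tensor_algebra_def A_RCOSETS_def' tensor_class_def)
  with add have "cls y = cls (y + y)" by (simp add: class_add)
  then have "cls y = cls 0"
    using null_minus[OF class_eqD[of y "y + y"]] by (intro class_eqI) simp
  with y show ?thesis by simp
qed

lemma additive_class_sum:
  assumes h: "h \<in> alg_hom S T T" and "finite D"
    and "\<And>d. d \<in> D \<Longrightarrow> p d \<in> pairs" "\<And>d. d \<in> D \<Longrightarrow> h (cls (frag_of (p d))) = cls (frag_of (q d))"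
  shows "h (cls (\<Sum>d\<in>D. frag_of (p d))) = cls (\<Sum>d\<in>D. frag_of (q d))"
  using assms(2-)
proof (induction D rule: finite_induct)
  case empty
  then show ?case using additive_class_zero[OF h] by simp
next
  case (insert d D)
  have "Poly_Mapping.keys (\<Sum>d\<in>D. frag_of (p d)) \<subseteq> pairs"
    using sum_closed_free_Abelian_group[of D "\<lambda>d. frag_of (p d)" pairs] insert.prems by (simp add: keys_frag_of)
  then have "cls (\<Sum>d\<in>D. frag_of (p d)) \<in> carrier T" by (rule class_closed)
  moreover have "cls (frag_of (p d)) \<in> carrier T"
    by (rule class_closed) (use insert.prems in \<open>simp add: keys_frag_of\<close>)
  ultimately have "h (cls (frag_of (p d)) \<oplus>\<^bsub>T\<^esub> cls (\<Sum>d\<in>D. frag_of (p d)))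
      = h (cls (frag_of (p d))) \<oplus>\<^bsub>T\<^esub> h (cls (\<Sum>d\<in>D. frag_of (p d)))"
    using h by (simp add: alg_hom_def)
  with insert show ?case by (simp add: class_add)
qed

text \<open>A \<open>K\<close>-linear functional \<open>c\<close> on \<open>R\<close> induces an
  additive map from the tensor product to \<open>A\<close> that sends the tensor of \<open>a\<close>
  and \<open>s\<close> to \<open>c s\<close> times \<open>a\<close>. Evaluated on a vanishing tensor
  it gives zero. With \<open>c\<close> a coefficient functional this separates the powers of the
  variable.\<close>

lemma class_functional_eq_zero:
  assumes D: "finite D" "b \<in> D \<rightarrow> carrier A" "r \<in> D \<rightarrow> carrier R"
    and null: "(\<Sum>d\<in>D. frag_of (b d, r d)) \<in> null"
    and c_closed: "\<And>s. s \<in> carrier R \<Longrightarrow> c s \<in> carrier K"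
    and c_add: "\<And>s t. \<lbrakk>s \<in> carrier R; t \<in> carrier R\<rbrakk> \<Longrightarrow> c (s \<oplus>\<^bsub>R\<^esub> t) = c s \<oplus>\<^bsub>K\<^esub> c t"
    and c_smult: "\<And>k s. \<lbrakk>k \<in> carrier K; s \<in> carrier R\<rbrakk> \<Longrightarrow> c (k \<odot>\<^bsub>R\<^esub> s) = k \<otimes>\<^bsub>K\<^esub> c s"
  shows "(\<Oplus>\<^bsub>A\<^esub>d\<in>D. c (r d) \<odot>\<^bsub>A\<^esub> b d) = \<zero>\<^bsub>A\<^esub>"
proof -
  have "(\<lambda>(a, s). c s \<odot>\<^bsub>A\<^esub> a) ` pairs \<subseteq> carrier (add_monoid A)"
    using c_closed by auto
  \<comment> \<open>The induced map is first built on the free abelian group by its universal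
    property and then shown to kill the relators.\<close>
  then obtain h where h: "h \<in> hom (free_Abelian_group pairs) (add_monoid A)"
    and h_of: "\<And>p. p \<in> pairs \<Longrightarrow> h (frag_of p) = (\<lambda>(a, s). c s \<odot>\<^bsub>A\<^esub> a) p"
    using comm_group.free_Abelian_group_universal[OF A.a_comm_group] by metis
  interpret h: group_hom "free_Abelian_group pairs" "add_monoid A" h
    using h comm_group.axioms(2)[OF A.a_comm_group]
    by (simp add: group_hom_def group_hom_axioms_def)
  have h_closed: "h x \<in> carrier A" if "Poly_Mapping.keys x \<subseteq> pairs" for x
    using h.hom_closed[of x] that by simp
  have h_zero: "h 0 = \<zero>\<^bsub>A\<^esub>"
    using h.hom_one by simp
  have h_add: "h (x + y) = h x \<oplus>\<^bsub>A\<^esub> h y" if "Poly_Mapping.keys x \<subseteq> pairs" "Poly_Mapping.keys y \<subseteq> pairs" for x y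
    using h.hom_mult[of x y] that by simp
  have h_minus: "h (- x) = \<ominus>\<^bsub>A\<^esub> h x" if "Poly_Mapping.keys x \<subseteq> pairs" for x
    using h.hom_inv[of x] that by (simp add: a_inv_def)
  have h_diff: "h (x - y) = h x \<ominus>\<^bsub>A\<^esub> h y" if "Poly_Mapping.keys x \<subseteq> pairs" "Poly_Mapping.keys y \<subseteq> pairs" for x y
    using h_add[of x "- y"] h_minus[of y] that by (simp add: a_minus_def)
  \<comment> \<open>The shape that the images under \<open>h\<close> of both additivity relators
    take.\<close>
  have cancel: "(u \<oplus>\<^bsub>A\<^esub> v) \<ominus>\<^bsub>A\<^esub> u \<ominus>\<^bsub>A\<^esub> v = \<zero>\<^bsub>A\<^esub>" if "u \<in> carrier A" "v \<in> carrier A" for u v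
  proof -
    have "(u \<oplus>\<^bsub>A\<^esub> v) \<ominus>\<^bsub>A\<^esub> u \<ominus>\<^bsub>A\<^esub> v = (u \<oplus>\<^bsub>A\<^esub> v) \<oplus>\<^bsub>A\<^esub> (\<ominus>\<^bsub>A\<^esub> u \<oplus>\<^bsub>A\<^esub> \<ominus>\<^bsub>A\<^esub> v)"
      unfolding a_minus_def by (rule A.a_assoc) (use that in auto)
    also have "\<dots> = \<zero>\<^bsub>A\<^esub>"
      using that by (simp add: A.minus_add[symmetric] A.r_neg)
    finally show ?thesis .
  qed
  have h_null: "h x = \<zero>\<^bsub>A\<^esub>" if "x \<in> null" for x
    using that
  proof (induction rule: null_induct)
    case (relator x)
    have keys: "Poly_Mapping.keys (frag_of p - frag_of q) \<subseteq> pairs" if "p \<in> pairs" "q \<in> pairs" for p q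
      using keys_diff[of "frag_of p" "frag_of q"] that by (auto simp: keys_frag_of)
    from relator show ?case
    proof (cases rule: tensor_relators_cases)
      case (left a b s)
      then have "h x = (c s \<odot>\<^bsub>A\<^esub> a \<oplus>\<^bsub>A\<^esub> c s \<odot>\<^bsub>A\<^esub> b) \<ominus>\<^bsub>A\<^esub> c s \<odot>\<^bsub>A\<^esub> a \<ominus>\<^bsub>A\<^esub> c s \<odot>\<^bsub>A\<^esub> b"
        using c_closed by (simp add: h_diff keys keys_frag_of h_of A.smult_r_distr)
      then show ?thesis using left c_closed by (simp add: cancel)
    next
      case (right a s t)
      then have "h x = (c s \<odot>\<^bsub>A\<^esub> a \<oplus>\<^bsub>A\<^esub> c t \<odot>\<^bsub>A\<^esub> a) \<ominus>\<^bsub>A\<^esub> c s \<odot>\<^bsub>A\<^esub> a \<ominus>\<^bsub>A\<^esub> c t \<odot>\<^bsub>A\<^esub> a"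
        using c_closed by (simp add: h_diff keys keys_frag_of h_of c_add A.smult_l_distr)
      then show ?thesis using right c_closed by (simp add: cancel)
    next
      case (balanced k a s)
      \<comment> \<open>Linearity of \<open>c\<close> matches the balanced relator once the two
        scalars are swapped in \<open>K\<close>.\<close>
      have "c s \<odot>\<^bsub>A\<^esub> (k \<odot>\<^bsub>A\<^esub> a) = (k \<otimes>\<^bsub>K\<^esub> c s) \<odot>\<^bsub>A\<^esub> a"
        using balanced c_closed by (metis A.R.m_comm A.smult_assoc1)
      with balanced show ?thesis
        using c_closed by (simp add: h_diff keys_frag_of h_of c_smult A.r_neg a_minus_def)
    qed
  qed (use h_zero in \<open>auto simp: h_add h_minus null_keys\<close>)
  \<comment> \<open>The support bound is carried along because \<open>h\<close> is additive only on
    formal sums supported in \<open>pairs\<close>.\<close>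
  have "finite D' \<Longrightarrow> D' \<subseteq> D \<Longrightarrow> Poly_Mapping.keys (\<Sum>d\<in>D'. frag_of (b d, r d)) \<subseteq> pairs \<and>
      h (\<Sum>d\<in>D'. frag_of (b d, r d)) = (\<Oplus>\<^bsub>A\<^esub>d\<in>D'. c (r d) \<odot>\<^bsub>A\<^esub> b d)" for D'
  proof (induction D' rule: finite_induct)
    case (insert d D')
    have bd: "b d \<in> carrier A" "r d \<in> carrier R" using insert.prems D by auto
    have fin: "(\<Oplus>\<^bsub>A\<^esub>d\<in>insert d D'. c (r d) \<odot>\<^bsub>A\<^esub> b d)
        = c (r d) \<odot>\<^bsub>A\<^esub> b d \<oplus>\<^bsub>A\<^esub> (\<Oplus>\<^bsub>A\<^esub>d\<in>D'. c (r d) \<odot>\<^bsub>A\<^esub> b d)"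
      by (rule A.finsum_insert) (use insert D c_closed in \<open>auto simp: Pi_iff subset_iff\<close>)
    have keys: "Poly_Mapping.keys (frag_of (b d, r d)) \<subseteq> pairs" using bd by (simp add: keys_frag_of)
    show ?case
      unfolding fin
      using insert bd keys keys_add[of "frag_of (b d, r d)" "\<Sum>d\<in>D'. frag_of (b d, r d)"]
      by (auto simp: h_add h_of)
  qed (simp add: h_zero)
  from this[of D] show ?thesis
    using h_null[OF null] D by simp
qed

end

text \<open>An algebra homomorphism sends relators to relators, so applying it to any representative
  yields the same class.\<close>

lemma class_tensor_map:
  assumes "scalar_extension K A R" "scalar_extension K B R" and g: "g \<in> alg_hom K A B"
  shows "tensor_map K B R g id (tensor_class K A R x) =
    tensor_class K B R (frag_extend (\<lambda>(a, r). frag_of (g a, r)) x)"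
proof -
  interpret A: scalar_extension K A R by fact
  interpret B: scalar_extension K B R by fact
  have null: "frag_extend (\<lambda>(a, r). frag_of (g a, r)) y \<in> B.null" if "y \<in> A.null" for y
    using that
  proof (induction rule: A.null_induct)
    case (relator y)
    have "frag_extend (\<lambda>(a, r). frag_of (g a, r)) y \<in> tensor_relators K B R"
      using relator
      by (cases rule: tensor_relators_cases)
        (use g in \<open>auto simp: alg_hom_def frag_extend_diff intro!: tensor_relators_intros\<close>)
    then show ?case by (rule B.relators_null)
  qed (auto simp: frag_extend_add frag_extend_minus intro: B.null_add B.null_minus)
  show ?thesis
    unfolding tensor_map_def id_apply
    by (rule A.class_UN, rule B.class_eqI)
      (auto simp: frag_extend_diff[symmetric] intro: null dest: A.class_mem)
qed

section \<open>Algebras generated by a Leavitt family\<close>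

locale assoc_algebra = nonassoc_algebra K M for K :: "('k, 'm) ring_scheme" and M :: "('k, 'a) module" (structure) +
  assumes mult_assoc:
    "\<lbrakk>x \<in> carrier M; y \<in> carrier M; z \<in> carrier M\<rbrakk> \<Longrightarrow> (x \<otimes> y) \<otimes> z = x \<otimes> (y \<otimes> z)"

text \<open>The Leavitt relations together with the statement that the family generates
  \<open>M\<close>, phrased as an induction principle. The argument can then proceed without terms
  and congruence classes.\<close>

locale leavitt_family = assoc_algebra K M for K :: "('k, 'm) ring_scheme" and M :: "('k, 'a) module" (structure) +
  fixes E :: "('v, 'e) pre_digraph" and vx :: "'v \<Rightarrow> 'a" and ed gh :: "'e \<Rightarrow> 'a"
  assumes graph: "wf_digraph E"
    and vx_closed [simp]: "v \<in> verts E \<Longrightarrow> vx v \<in> carrier M"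
    and ed_closed [simp]: "f \<in> arcs E \<Longrightarrow> ed f \<in> carrier M"
    and gh_closed [simp]: "f \<in> arcs E \<Longrightarrow> gh f \<in> carrier M"
    and vx_vx: "\<lbrakk>u \<in> verts E; v \<in> verts E\<rbrakk> \<Longrightarrow> vx u \<otimes> vx v = (if u = v then vx u else \<zero>)"
    and tail_ed: "f \<in> arcs E \<Longrightarrow> vx (tail E f) \<otimes> ed f = ed f"
    and ed_head: "f \<in> arcs E \<Longrightarrow> ed f \<otimes> vx (head E f) = ed f"
    and head_gh: "f \<in> arcs E \<Longrightarrow> vx (head E f) \<otimes> gh f = gh f"
    and gh_tail: "f \<in> arcs E \<Longrightarrow> gh f \<otimes> vx (tail E f) = gh f"
    and gh_ed: "\<lbrakk>f \<in> arcs E; g \<in> arcs E\<rbrakk> \<Longrightarrow>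
      gh f \<otimes> ed g = (if f = g then vx (head E f) else \<zero>)"
    and vx_regular: "regular_vertex E v \<Longrightarrow>
      vx v = (\<Oplus>f\<in>{f \<in> arcs E. tail E f = v}. ed f \<otimes> gh f)"
    and generated: "\<lbrakk>x \<in> carrier M; vx ` verts E \<subseteq> S; ed ` arcs E \<subseteq> S; gh ` arcs E \<subseteq> S; \<zero> \<in> S;
      \<And>y z. \<lbrakk>y \<in> S; z \<in> S\<rbrakk> \<Longrightarrow> y \<oplus> z \<in> S; \<And>y z. \<lbrakk>y \<in> S; z \<in> S\<rbrakk> \<Longrightarrow> y \<otimes> z \<in> S;
      \<And>k y. \<lbrakk>k \<in> carrier K; y \<in> S\<rbrakk> \<Longrightarrow> k \<odot> y \<in> S; S \<subseteq> carrier M\<rbrakk> \<Longrightarrow> x \<in> S"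
begin

lemma head_in_verts [simp]: "f \<in> arcs E \<Longrightarrow> head E f \<in> verts E"
  and tail_in_verts [simp]: "f \<in> arcs E \<Longrightarrow> tail E f \<in> verts E"
  using graph by (auto simp: wf_digraph_def)

lemmas closed_simps [simp] = mult_closed

text \<open>Inserting the source vertex in front of \<open>ed f\<close> reduces this to the
  orthogonality of the vertices.\<close>

lemma vx_ed:
  assumes "v \<in> verts E" "f \<in> arcs E"
  shows "vx v \<otimes> ed f = (if v = tail E f then ed f else \<zero>)"
  using mult_assoc[of "vx v" "vx (tail E f)" "ed f"] assms by (simp add: tail_ed vx_vx split: if_splits)

lemma gh_vx:
  assumes "v \<in> verts E" "f \<in> arcs E"
  shows "gh f \<otimes> vx v = (if v = tail E f then gh f else \<zero>)"
  using mult_assoc[of "gh f" "vx (tail E f)" "vx v"] assms by (auto simp add: gh_tail vx_vx split: if_splits)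

lemma sum_vx_closed [simp]: "V \<subseteq> verts E \<Longrightarrow> (\<Oplus>v\<in>V. vx v) \<in> carrier M"
  by (rule finsum_closed) auto

lemma sum_ed_gh_closed [simp]: "F \<subseteq> arcs E \<Longrightarrow> (\<Oplus>f\<in>F. ed f \<otimes> gh f) \<in> carrier M"
  by (rule finsum_closed) auto

section \<open>Spans of paths and of homogeneous monomials\<close>

text \<open>The span of the paths of length \<open>n\<close>, built by prepending edges.
  Composability is not demanded, since products of edges that do not compose vanish by the
  relations.\<close>

inductive path_span :: "nat \<Rightarrow> 'a \<Rightarrow> bool" where
  zero: "path_span n \<zero>"
| vertex: "\<lbrakk>k \<in> carrier K; v \<in> verts E\<rbrakk> \<Longrightarrow> path_span 0 (k \<odot> vx v)"
| edge: "\<lbrakk>f \<in> arcs E; path_span n q\<rbrakk> \<Longrightarrow> path_span (Suc n) (ed f \<otimes> q)"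
| add: "\<lbrakk>path_span n p; path_span n q\<rbrakk> \<Longrightarrow> path_span n (p \<oplus> q)"

text \<open>\<open>hspan N d\<close> holds on the span of the \<open>\<alpha> \<beta>\<^sup>*\<close> with \<open>\<bar>\<alpha>\<bar> - \<bar>\<beta>\<bar> = d\<close> and \<open>\<bar>\<beta>\<bar> \<le> N\<close>.\<close>

inductive hspan :: "nat \<Rightarrow> int \<Rightarrow> 'a \<Rightarrow> bool" where
  zero: "hspan N d \<zero>"
| path: "path_span n p \<Longrightarrow> hspan N (int n) p"
| ghost: "\<lbrakk>f \<in> arcs E; hspan N (d + 1) b\<rbrakk> \<Longrightarrow> hspan (Suc N) d (b \<otimes> gh f)"
| add: "\<lbrakk>hspan N d a; hspan N d b\<rbrakk> \<Longrightarrow> hspan N d (a \<oplus> b)"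

lemma path_span_closed [simp]: "path_span n p \<Longrightarrow> p \<in> carrier M"
  by (induction rule: path_span.induct) auto

lemma hspan_closed [simp]: "hspan N d a \<Longrightarrow> a \<in> carrier M"
  by (induction rule: hspan.induct) auto

lemma path_span_smult: "path_span n p \<Longrightarrow> k \<in> carrier K \<Longrightarrow> path_span n (k \<odot> p)"
proof (induction rule: path_span.induct)
  case (vertex l v)
  then show ?case by (simp add: smult_assoc1[symmetric] path_span.vertex)
next
  case (edge f n q)
  then show ?case by (simp add: mult_smult_right[symmetric] path_span.edge)
qed (auto simp: smult_r_distr intro: path_span.intros)

lemma hspan_smult: "hspan N d a \<Longrightarrow> k \<in> carrier K \<Longrightarrow> hspan N d (k \<odot> a)"
proof (induction rule: hspan.induct)
  case (ghost f N d b)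
  then show ?case by (simp add: mult_smult_left[symmetric] hspan.ghost)
qed (auto simp: smult_r_distr intro: hspan.intros path_span_smult)

lemma path_span_vx_left: "path_span n p \<Longrightarrow> v \<in> verts E \<Longrightarrow> path_span n (vx v \<otimes> p)"
proof (induction rule: path_span.induct)
  case (vertex k u)
  then show ?case by (auto simp: mult_smult_right vx_vx intro: path_span.intros)
next
  case (edge f n q)
  then show ?case by (auto simp: mult_assoc[symmetric] vx_ed intro: path_span.intros)
qed (auto simp: mult_add_right intro: path_span.intros)

text \<open>A ghost edge on the left cancels the first edge of a path or kills it. The length is a
  separate equation so that the induction can run over the span.\<close>

lemma path_span_gh_left:
  "path_span m p \<Longrightarrow> m = Suc n \<Longrightarrow> f \<in> arcs E \<Longrightarrow> path_span n (gh f \<otimes> p)"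
proof (induction rule: path_span.induct)
  case (edge g n q)
  then show ?case
    by (auto simp: mult_assoc[symmetric] gh_ed intro: path_span.intros path_span_vx_left)
qed (auto simp: mult_add_right intro: path_span.intros)

lemma path_span_vx_right: "path_span n p \<Longrightarrow> v \<in> verts E \<Longrightarrow> path_span n (p \<otimes> vx v)"
proof (induction rule: path_span.induct)
  case (vertex k u)
  then show ?case by (auto simp: mult_smult_left vx_vx intro: path_span.intros)
next
  case (edge f n q)
  then show ?case by (auto simp: mult_assoc intro: path_span.intros)
qed (auto simp: mult_add_left intro: path_span.intros)

lemma path_span_ed_right: "path_span n p \<Longrightarrow> f \<in> arcs E \<Longrightarrow> path_span (Suc n) (p \<otimes> ed f)"
proof (induction rule: path_span.induct)
  case (vertex k u)
  \<comment> \<open>An edge is a path of length one once the scalar is moved to its final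
    vertex.\<close>
  have "k \<odot> ed f = ed f \<otimes> (k \<odot> vx (head E f))"
    using vertex by (simp add: mult_smult_right ed_head)
  moreover have "path_span (Suc 0) (ed f \<otimes> (k \<odot> vx (head E f)))"
    using vertex by (auto intro!: path_span.intros)
  ultimately show ?case using vertex by (auto simp: mult_smult_left vx_ed path_span.zero)
next
  case (edge g n q)
  then show ?case by (auto simp: mult_assoc intro: path_span.intros)
qed (auto simp: mult_add_left intro: path_span.intros)

lemma hspan_mono: "hspan N d a \<Longrightarrow> hspan (Suc N) d a"
  by (induction rule: hspan.induct) (auto intro: hspan.intros)

lemma hspan_le: "N \<le> N' \<Longrightarrow> hspan N d a \<Longrightarrow> hspan N' d a"
  by (induction rule: dec_induct) (auto intro: hspan_mono)

lemma hspan_vx_right: "hspan N d a \<Longrightarrow> v \<in> verts E \<Longrightarrow> hspan N d (a \<otimes> vx v)"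
proof (induction rule: hspan.induct)
  case (ghost f N d b)
  then show ?case by (auto simp: mult_assoc gh_vx intro: hspan.intros)
qed (auto simp: mult_add_left intro: hspan.intros path_span_vx_right)

text \<open>An edge on the right cancels the last ghost edge, is annihilated by a different one, or
  lengthens a ghost-free path; in no case does the number of ghosts grow.\<close>

lemma hspan_ed_right: "hspan N d a \<Longrightarrow> f \<in> arcs E \<Longrightarrow> hspan N (d + 1) (a \<otimes> ed f)"
proof (induction rule: hspan.induct)
  case (path n p N)
  then show ?case using hspan.path[OF path_span_ed_right[OF path]] by (simp add: add.commute)
next
  case (ghost g N d b)
  then show ?case
    by (auto simp: mult_assoc gh_ed intro: hspan.intros intro!: hspan_mono hspan_vx_right)
qed (auto simp: mult_add_left intro: hspan.intros)

lemma hspan_gh_right: "hspan N d a \<Longrightarrow> f \<in> arcs E \<Longrightarrow> hspan (Suc N) (d - 1) (a \<otimes> gh f)"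
  by (rule hspan.ghost) auto

text \<open>The bound zero excludes ghosts. The alternative \<open>p = \<zero>\<close> is what
  remains for negative \<open>d\<close>, which is the degree of no path.\<close>

lemma hspan_0D: "hspan N d p \<Longrightarrow> N = 0 \<Longrightarrow> p = \<zero> \<or> (\<exists>n. d = int n \<and> path_span n p)"
  by (induction rule: hspan.induct) (auto intro: path_span.intros)

section \<open>Local units\<close>

text \<open>Left and right units of the span are sums over finite sets of edges or vertices; quantifying
  over all larger finite sets makes the statements stable under addition.\<close>

lemma path_span_Suc_unit:
  "path_span m p \<Longrightarrow> m = Suc n \<Longrightarrow> \<exists>F. finite F \<and> F \<subseteq> arcs E \<and>
     (\<forall>G. finite G \<longrightarrow> F \<subseteq> G \<longrightarrow> G \<subseteq> arcs E \<longrightarrow> (\<Oplus>f\<in>G. ed f \<otimes> (gh f \<otimes> p)) = p)"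
proof (induction rule: path_span.induct)
  case (zero n)
  have "(\<Oplus>f\<in>G. ed f \<otimes> (gh f \<otimes> \<zero>)) = \<zero>" if "G \<subseteq> arcs E" for G
    by (rule finsum_eq_zero) (use that in auto)
  then show ?case by blast
next
  case (edge g n q)
  have "(\<Oplus>f\<in>G. ed f \<otimes> (gh f \<otimes> (ed g \<otimes> q))) = ed g \<otimes> q"
    if "finite G" "{g} \<subseteq> G" "G \<subseteq> arcs E" for G
  proof -
    \<comment> \<open>By \<open>gh_ed\<close> every summand except the one at \<open>g\<close>
      vanishes.\<close>
    have *: "ed f \<otimes> (gh f \<otimes> (ed g \<otimes> q)) = (if f = g then ed g \<otimes> q else \<zero>)" if "f \<in> arcs E" for f
    proof -
      have "ed f \<otimes> (gh f \<otimes> (ed g \<otimes> q)) = (ed f \<otimes> (gh f \<otimes> ed g)) \<otimes> q"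
        using edge that by (simp add: mult_assoc)
      then show ?thesis using edge that by (auto simp: gh_ed ed_head)
    qed
    show ?thesis
      by (subst finsum_eq_single[where i = g]) (use that edge * in auto)
  qed
  then show ?case using edge by (intro exI[of _ "{g}"]) auto
next
  case (add m p q)
  then obtain F F' where F: "finite F" "F \<subseteq> arcs E" "finite F'" "F' \<subseteq> arcs E"
    "\<And>G. finite G \<Longrightarrow> F \<subseteq> G \<Longrightarrow> G \<subseteq> arcs E \<Longrightarrow> (\<Oplus>f\<in>G. ed f \<otimes> (gh f \<otimes> p)) = p"
    "\<And>G. finite G \<Longrightarrow> F' \<subseteq> G \<Longrightarrow> G \<subseteq> arcs E \<Longrightarrow> (\<Oplus>f\<in>G. ed f \<otimes> (gh f \<otimes> q)) = q"
    by blast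
  have "(\<Oplus>f\<in>G. ed f \<otimes> (gh f \<otimes> (p \<oplus> q))) = p \<oplus> q"
    if "finite G" "F \<union> F' \<subseteq> G" "G \<subseteq> arcs E" for G
  proof -
    have "(\<Oplus>f\<in>G. ed f \<otimes> (gh f \<otimes> (p \<oplus> q)))
        = (\<Oplus>f\<in>G. ed f \<otimes> (gh f \<otimes> p) \<oplus> ed f \<otimes> (gh f \<otimes> q))"
      by (rule finsum_cong') (use that add.hyps in \<open>auto simp: mult_add_right subset_iff\<close>)
    also have "\<dots> = (\<Oplus>f\<in>G. ed f \<otimes> (gh f \<otimes> p)) \<oplus> (\<Oplus>f\<in>G. ed f \<otimes> (gh f \<otimes> q))"
      by (rule finsum_addf[of "\<lambda>f. ed f \<otimes> (gh f \<otimes> p)" G "\<lambda>f. ed f \<otimes> (gh f \<otimes> q)"])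
        (use that add.hyps in auto)
    finally show ?thesis using F that by simp
  qed
  then show ?case using F by (intro exI[of _ "F \<union> F'"]) auto
qed auto

text \<open>The unit expresses \<open>p\<close> as a finite sum of terms
  \<open>ed f \<otimes> (gh f \<otimes> p)\<close>, all zero here. This drives the inductions on
  path length.\<close>

lemma path_span_Suc_eq_zero:
  assumes "path_span (Suc n) p" "\<And>f. f \<in> arcs E \<Longrightarrow> gh f \<otimes> p = \<zero>"
  shows "p = \<zero>"
proof -
  obtain F where F: "finite F" "F \<subseteq> arcs E" "(\<Oplus>f\<in>F. ed f \<otimes> (gh f \<otimes> p)) = p"
    using path_span_Suc_unit[OF assms(1) HOL.refl] by blast
  moreover have "(\<Oplus>f\<in>F. ed f \<otimes> (gh f \<otimes> p)) = \<zero>"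
    by (rule finsum_eq_zero) (use F assms in auto)
  ultimately show ?thesis by simp
qed

text \<open>The elements with this property contain the generators, each of which is fixed by a
  single vertex, and form a subalgebra.\<close>

lemma local_unit:
  assumes "x \<in> carrier M"
  shows "\<exists>V. finite V \<and> V \<subseteq> verts E \<and>
    (\<forall>W. finite W \<longrightarrow> V \<subseteq> W \<longrightarrow> W \<subseteq> verts E \<longrightarrow> x \<otimes> (\<Oplus>v\<in>W. vx v) = x)" (is "?P x")
proof -
  define S where "S = {x \<in> carrier M. ?P x}"
  have in_S: "x \<in> S" if xv: "x \<otimes> vx v = x" and x: "x \<in> carrier M" and v: "v \<in> verts E" for x v
  proof -
    have "x \<otimes> (\<Oplus>v\<in>W. vx v) = x" if "finite W" "{v} \<subseteq> W" "W \<subseteq> verts E" for W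
    proof -
      have "x \<otimes> (\<Oplus>v\<in>W. vx v) = (x \<otimes> vx v) \<otimes> (\<Oplus>v\<in>W. vx v)" using xv by simp
      also have "\<dots> = x \<otimes> (vx v \<otimes> (\<Oplus>v\<in>W. vx v))"
        using x v that by (intro mult_assoc) auto
      also have "vx v \<otimes> (\<Oplus>v\<in>W. vx v) = (\<Oplus>w\<in>W. vx v \<otimes> vx w)"
        by (rule mult_finsum_right) (use v that in auto)
      also have "\<dots> = vx v"
        by (subst finsum_eq_single[where i = v]) (use v that in \<open>auto simp: vx_vx\<close>)
      finally show ?thesis by (simp add: xv)
    qed
    then have "?P x" using v by (intro exI[of _ "{v}"]) auto
    then show ?thesis using x by (simp add: S_def)
  qed
  have "x \<in> S"
    using assms
  proof (rule generated)
    show "vx ` verts E \<subseteq> S"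
      proof (rule image_subsetI)
      show "vx v \<in> S" if "v \<in> verts E" for v
        by (rule in_S[of _ v]) (use that in \<open>auto simp: vx_vx\<close>)
    qed
    show "ed ` arcs E \<subseteq> S"
      by (rule image_subsetI, rule in_S[OF ed_head]) auto
    show "gh ` arcs E \<subseteq> S"
      by (rule image_subsetI, rule in_S[OF gh_tail]) auto
    show "\<zero> \<in> S" unfolding S_def by (auto intro!: exI[of _ "{}"])
  next
    fix y z assume yz: "y \<in> S" "z \<in> S"
    then obtain V V' where V: "finite V" "V \<subseteq> verts E" "finite V'" "V' \<subseteq> verts E"
      "\<And>W. finite W \<Longrightarrow> V \<subseteq> W \<Longrightarrow> W \<subseteq> verts E \<Longrightarrow> y \<otimes> (\<Oplus>v\<in>W. vx v) = y"
      "\<And>W. finite W \<Longrightarrow> V' \<subseteq> W \<Longrightarrow> W \<subseteq> verts E \<Longrightarrow> z \<otimes> (\<Oplus>v\<in>W. vx v) = z"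
      unfolding S_def by blast
    show "y \<oplus> z \<in> S"
      unfolding S_def
      using V yz by (auto simp: mult_add_left S_def intro!: exI[of _ "V \<union> V'"])
    \<comment> \<open>A right unit for the right factor is one for the product.\<close>
    show "y \<otimes> z \<in> S"
      unfolding S_def
      using V yz by (auto simp: mult_assoc S_def intro!: exI[of _ "V'"])
  next
    fix k y assume ky: "k \<in> carrier K" "y \<in> S"
    from ky obtain V where V: "finite V" "V \<subseteq> verts E"
      "\<And>W. finite W \<Longrightarrow> V \<subseteq> W \<Longrightarrow> W \<subseteq> verts E \<Longrightarrow> y \<otimes> (\<Oplus>v\<in>W. vx v) = y"
      unfolding S_def by blast
    then show "k \<odot> y \<in> S"
      unfolding S_def
      using ky by (auto simp: mult_smult_left S_def intro!: exI[of _ "V"])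
  qed (auto simp: S_def)
  then show ?thesis by (simp add: S_def)
qed

text \<open>Right local units are sums of vertices, so vanishing can be tested one vertex at a
  time.\<close>

lemma eq_zero_if_vx_right:
  assumes x: "x \<in> carrier M" and 0: "\<And>v. v \<in> verts E \<Longrightarrow> x \<otimes> vx v = \<zero>"
  shows "x = \<zero>"
proof -
  obtain V where V: "finite V" "V \<subseteq> verts E" "x \<otimes> (\<Oplus>v\<in>V. vx v) = x"
    using local_unit[OF x] by blast
  have "x \<otimes> (\<Oplus>v\<in>V. vx v) = (\<Oplus>v\<in>V. x \<otimes> vx v)"
    by (rule mult_finsum_right) (use V x in auto)
  also have "\<dots> = \<zero>" by (rule finsum_eq_zero) (use 0 V in auto)
  finally show ?thesis using V by simp
qed

text \<open>Length zero gives combinations of orthogonal idempotents, and multiplying by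
  \<open>vx v\<close> isolates the coefficient at \<open>v\<close>.\<close>

lemma path_span_0_vx:
  "path_span n p \<Longrightarrow> n = 0 \<Longrightarrow> v \<in> verts E \<Longrightarrow>
    p \<otimes> vx v = vx v \<otimes> p \<and> (\<exists>k\<in>carrier K. p \<otimes> vx v = k \<odot> vx v)"
proof (induction rule: path_span.induct)
  case (zero n)
  then show ?case by (auto intro!: bexI[of _ "\<zero>\<^bsub>K\<^esub>"])
next
  case (vertex k u)
  then show ?case
    by (auto simp: mult_smult_left mult_smult_right vx_vx intro: bexI[of _ "\<zero>\<^bsub>K\<^esub>"] bexI[of _ k])
next
  case (add n p q)
  then obtain k l where "k \<in> carrier K" "l \<in> carrier K" "p \<otimes> vx v = k \<odot> vx v" "q \<otimes> vx v = l \<odot> vx v"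
    by blast
  with add show ?case
    by (auto simp: mult_add_left mult_add_right smult_l_distr intro!: bexI[of _ "k \<oplus>\<^bsub>K\<^esub> l"])
qed auto

section \<open>Terms that end in a ghost edge\<close>

text \<open>Describes sums of elements \<open>b \<otimes> gh f\<close> through two consequences: an
  edge on the right removes the last ghost, lowering the bound to \<open>N\<close>, and finitely
  many \<open>ed f \<otimes> gh f\<close> add up to a right unit.\<close>

definition ghost_part :: "nat \<Rightarrow> int \<Rightarrow> 'a \<Rightarrow> bool" where
  "ghost_part N d c \<longleftrightarrow> c \<in> carrier M \<and> (\<forall>g\<in>arcs E. hspan N (d + 1) (c \<otimes> ed g)) \<and>
     (\<exists>F. finite F \<and> F \<subseteq> arcs E \<and>
       (\<forall>G. finite G \<longrightarrow> F \<subseteq> G \<longrightarrow> G \<subseteq> arcs E \<longrightarrow> c \<otimes> (\<Oplus>f\<in>G. ed f \<otimes> gh f) = c))"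

lemma ghost_part_zero: "ghost_part N d \<zero>"
  by (auto simp: ghost_part_def intro: hspan.zero)

lemma ghost_part_add:
  assumes "ghost_part N d b" "ghost_part N d c"
  shows "ghost_part N d (b \<oplus> c)"
proof -
  obtain F where F: "finite F" "F \<subseteq> arcs E"
    "\<And>G. finite G \<Longrightarrow> F \<subseteq> G \<Longrightarrow> G \<subseteq> arcs E \<Longrightarrow> b \<otimes> (\<Oplus>f\<in>G. ed f \<otimes> gh f) = b"
    using assms(1) unfolding ghost_part_def by blast
  obtain F' where F': "finite F'" "F' \<subseteq> arcs E"
    "\<And>G. finite G \<Longrightarrow> F' \<subseteq> G \<Longrightarrow> G \<subseteq> arcs E \<Longrightarrow> c \<otimes> (\<Oplus>f\<in>G. ed f \<otimes> gh f) = c"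
    using assms(2) unfolding ghost_part_def by blast
  have cl: "b \<in> carrier M" "c \<in> carrier M"
    using assms by (auto simp: ghost_part_def)
  have "(b \<oplus> c) \<otimes> (\<Oplus>f\<in>G. ed f \<otimes> gh f) = b \<oplus> c"
    if "finite G" "F \<union> F' \<subseteq> G" "G \<subseteq> arcs E" for G
    using F F' that cl by (simp add: mult_add_left)
  moreover have "hspan N (d + 1) ((b \<oplus> c) \<otimes> ed g)" if "g \<in> arcs E" for g
    using assms that by (auto simp: ghost_part_def mult_add_left intro: hspan.add)
  ultimately show ?thesis
    using F(1,2) F'(1,2) cl unfolding ghost_part_def
    by (intro conjI ballI exI[of _ "F \<union> F'"] allI impI) auto
qed

text \<open>The set \<open>{g}\<close> suffices for the unit, since \<open>gh g\<close> annihilates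
  all other edges. An edge on the right leaves zero or \<open>b\<close> times a vertex.\<close>

lemma ghost_part_ghost:
  assumes g: "g \<in> arcs E" and b: "hspan N (d + 1) b"
  shows "ghost_part N d (b \<otimes> gh g)"
proof -
  have "(b \<otimes> gh g) \<otimes> (\<Oplus>f\<in>G. ed f \<otimes> gh f) = b \<otimes> gh g"
    if G: "finite G" "{g} \<subseteq> G" "G \<subseteq> arcs E" for G
  proof -
    have "(b \<otimes> gh g) \<otimes> (\<Oplus>f\<in>G. ed f \<otimes> gh f) = (\<Oplus>f\<in>G. (b \<otimes> gh g) \<otimes> (ed f \<otimes> gh f))"
      by (rule mult_finsum_right) (use G g b in auto)
    also have "\<dots> = (b \<otimes> gh g) \<otimes> (ed g \<otimes> gh g)"
    proof (rule finsum_eq_single)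
      fix f assume f: "f \<in> G" "f \<noteq> g"
      have "(b \<otimes> gh g) \<otimes> (ed f \<otimes> gh f) = b \<otimes> ((gh g \<otimes> ed f) \<otimes> gh f)"
        using f G g b by (auto simp: mult_assoc subset_iff)
      then show "(b \<otimes> gh g) \<otimes> (ed f \<otimes> gh f) = \<zero>"
        using f G g b by (auto simp: gh_ed subset_iff)
    qed (use G g b in auto)
    also have "\<dots> = b \<otimes> ((gh g \<otimes> ed g) \<otimes> gh g)"
      using g b by (simp add: mult_assoc)
    finally show ?thesis using g by (simp add: gh_ed head_gh)
  qed
  moreover have "hspan N (d + 1) ((b \<otimes> gh g) \<otimes> ed f)" if "f \<in> arcs E" for f
    using that g b by (auto simp: mult_assoc gh_ed intro!: hspan.zero hspan_vx_right)
  ultimately show ?thesis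
    using g b unfolding ghost_part_def
    by (intro conjI ballI exI[of _ "{g}"] allI impI) auto
qed

text \<open>The spanning elements are either paths without ghosts or end in a ghost edge; the two
  kinds are collected in \<open>p\<close> and \<open>c\<close>.\<close>

lemma hspan_Suc_split:
  "hspan N' d a \<Longrightarrow> N' = Suc N \<Longrightarrow> \<exists>p c. a = p \<oplus> c \<and> hspan 0 d p \<and> ghost_part N d c"
proof (induction rule: hspan.induct)
  case (zero N' d)
  have "\<zero> = \<zero> \<oplus> \<zero>" by simp
  then show ?case using hspan.zero ghost_part_zero by blast
next
  case (path n p N')
  then have "p = p \<oplus> \<zero>" by simp
  then show ?case using hspan.path[OF path(1)] ghost_part_zero by blast
next
  case (ghost g N' d b)
  then have "b \<otimes> gh g = \<zero> \<oplus> b \<otimes> gh g" by simp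
  then show ?case using ghost hspan.zero ghost_part_ghost by blast
next
  case (add N' d a b)
  then obtain p c p' c' where *: "a = p \<oplus> c" "hspan 0 d p" "ghost_part N d c"
    "b = p' \<oplus> c'" "hspan 0 d p'" "ghost_part N d c'"
    by blast
  then have "a \<oplus> b = (p \<oplus> p') \<oplus> (c \<oplus> c')"
    by (simp add: a_ac ghost_part_def)
  then show ?case using * hspan.add ghost_part_add by blast
qed

section \<open>Homogeneous elements of an ideal without nonzero multiples of vertices\<close>

context
  fixes I
  assumes I_left: "\<And>x y. \<lbrakk>x \<in> carrier M; y \<in> I; y \<in> carrier M\<rbrakk> \<Longrightarrow> x \<otimes> y \<in> I"
    and I_right: "\<And>x y. \<lbrakk>x \<in> carrier M; y \<in> I; y \<in> carrier M\<rbrakk> \<Longrightarrow> y \<otimes> x \<in> I"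
    and zero_in_I: "\<zero> \<in> I"
    and vx_notin_I: "\<And>k v. \<lbrakk>k \<in> carrier K; v \<in> verts E; k \<odot> vx v \<in> I\<rbrakk> \<Longrightarrow> k = \<zero>\<^bsub>K\<^esub>"
begin

text \<open>Ghost edges on the left shorten the paths and stay in \<open>I\<close>. At length zero
  each \<open>p \<otimes> vx v\<close> is a multiple of a vertex in \<open>I\<close>, so its
  coefficient is zero.\<close>

lemma path_span_in_ideal: "\<lbrakk>path_span n p; p \<in> I\<rbrakk> \<Longrightarrow> p = \<zero>"
proof (induction n arbitrary: p)
  case 0
  show ?case
  proof (rule eq_zero_if_vx_right)
    fix v assume v: "v \<in> verts E"
    then obtain k where k: "k \<in> carrier K" "p \<otimes> vx v = k \<odot> vx v"
      using path_span_0_vx[OF 0(1)] by blast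
    moreover have "p \<otimes> vx v \<in> I"
      using 0 v I_right by simp
    ultimately show "p \<otimes> vx v = \<zero>"
      using v vx_notin_I[of k v] by simp
  qed (use 0 in auto)
next
  case (Suc n)
  show ?case
  proof (rule path_span_Suc_eq_zero[OF Suc.prems(1)])
    fix f assume "f \<in> arcs E"
    then show "gh f \<otimes> p = \<zero>"
      using Suc I_left path_span_gh_left by simp
  qed
qed

text \<open>At length zero, \<open>p\<close> acts at the source of \<open>g\<close> as a scalar
  \<open>k\<close>, and cancelling \<open>g\<close> by its ghost leaves \<open>k\<close> times the
  range vertex. Longer paths are shortened by ghosts on the left.\<close>

lemma path_span_ed_eq_zero:
  "\<lbrakk>path_span n p; g \<in> arcs E; p \<otimes> ed g = \<zero>\<rbrakk> \<Longrightarrow> p \<otimes> vx (tail E g) = \<zero>"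
proof (induction n arbitrary: p)
  case 0
  obtain k where k: "k \<in> carrier K" "p \<otimes> vx (tail E g) = k \<odot> vx (tail E g)"
    using path_span_0_vx[OF 0(1) HOL.refl tail_in_verts[OF 0(2)]] by blast
  have "\<zero> = p \<otimes> (vx (tail E g) \<otimes> ed g)"
    using 0 by (simp add: tail_ed)
  also have "\<dots> = (p \<otimes> vx (tail E g)) \<otimes> ed g"
    using 0(1,2) by (simp add: mult_assoc)
  also have "\<dots> = k \<odot> ed g"
    unfolding k(2) using 0(2) k(1) by (simp add: mult_smult_left tail_ed)
  finally have "gh g \<otimes> (k \<odot> ed g) = \<zero>"
    using 0(2) by (metis mult_zero_right gh_closed)
  then have "k \<odot> vx (head E g) = \<zero>"
    using 0 k by (simp add: mult_smult_right gh_ed)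
  \<comment> \<open>As zero lies in \<open>I\<close>, the hypothesis on vertices says in particular
    that a scalar killing a vertex is zero.\<close>
  then have "k = \<zero>\<^bsub>K\<^esub>"
    using k 0 vx_notin_I[of k "head E g"] zero_in_I by simp
  then show ?case using k 0 by simp
next
  case (Suc n)
  show ?case
  proof (rule path_span_Suc_eq_zero[OF path_span_vx_right[OF Suc.prems(1)]])
    fix f assume f: "f \<in> arcs E"
    have "(gh f \<otimes> p) \<otimes> vx (tail E g) = \<zero>"
      by (rule Suc.IH) (use Suc.prems f path_span_gh_left in \<open>auto simp: mult_assoc\<close>)
    then show "gh f \<otimes> (p \<otimes> vx (tail E g)) = \<zero>"
      using Suc.prems f by (simp add: mult_assoc)
  qed (use Suc.prems in auto)
qed

lemma hspan_0_in_ideal: "\<lbrakk>hspan 0 d p; p \<in> I\<rbrakk> \<Longrightarrow> p = \<zero>"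
  using hspan_0D path_span_in_ideal by blast

lemma hspan_0_ed_eq_zero:
  "\<lbrakk>hspan 0 d p; g \<in> arcs E; p \<otimes> ed g = \<zero>\<rbrakk> \<Longrightarrow> p \<otimes> vx (tail E g) = \<zero>"
  using hspan_0D[of 0 d p] path_span_ed_eq_zero by auto

text \<open>Expand \<open>c\<close> by its right unit: \<open>gh f \<otimes> vx v\<close> vanishes
  unless \<open>f\<close> leaves \<open>v\<close>, and then \<open>c \<otimes> ed f\<close>
  vanishes.\<close>

lemma ghost_part_vx_eq_zero:
  assumes c: "ghost_part N d c" and v: "v \<in> verts E"
    and 0: "\<And>f. \<lbrakk>f \<in> arcs E; tail E f = v\<rbrakk> \<Longrightarrow> c \<otimes> ed f = \<zero>"
  shows "c \<otimes> vx v = \<zero>"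
proof -
  obtain F where F: "finite F" "F \<subseteq> arcs E" "c \<otimes> (\<Oplus>f\<in>F. ed f \<otimes> gh f) = c"
    using c unfolding ghost_part_def by blast
  have cM: "c \<in> carrier M" using c by (simp add: ghost_part_def)
  have "c \<otimes> vx v = (\<Oplus>f\<in>F. c \<otimes> (ed f \<otimes> gh f)) \<otimes> vx v"
    using F cM by (subst mult_finsum_right[symmetric]) auto
  also have "\<dots> = (\<Oplus>f\<in>F. (c \<otimes> (ed f \<otimes> gh f)) \<otimes> vx v)"
    by (rule mult_finsum_left) (use F cM v in auto)
  also have "\<dots> = \<zero>"
  proof (rule finsum_eq_zero)
    fix f assume "f \<in> F"
    then have f: "f \<in> arcs E" using F by auto
    have "(c \<otimes> (ed f \<otimes> gh f)) \<otimes> vx v = (c \<otimes> ed f) \<otimes> (gh f \<otimes> vx v)"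
      using f cM v by (simp add: mult_assoc)
    also have "\<dots> = \<zero>"
      using f v cM 0[of f] by (auto simp: gh_vx)
    finally show "(c \<otimes> (ed f \<otimes> gh f)) \<otimes> vx v = \<zero>" .
  qed
  finally show ?thesis .
qed

text \<open>Outside the finite set of edges in the right unit of \<open>c\<close>, all products
  \<open>gh f \<otimes> ed g\<close> are zero. At an infinite emitter this provides an edge that
  \<open>c\<close> annihilates.\<close>

lemma ghost_part_ed_eq_zero:
  assumes c: "ghost_part N d c"
  obtains F where "finite F" "\<And>g. g \<in> arcs E - F \<Longrightarrow> c \<otimes> ed g = \<zero>"
proof -
  obtain F where F: "finite F" "F \<subseteq> arcs E" "c \<otimes> (\<Oplus>f\<in>F. ed f \<otimes> gh f) = c"
    using c unfolding ghost_part_def by blast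
  have cM: "c \<in> carrier M" using c by (simp add: ghost_part_def)
  have "c \<otimes> ed g = \<zero>" if g: "g \<in> arcs E - F" for g
  proof -
    have "c \<otimes> ed g = c \<otimes> ((\<Oplus>f\<in>F. ed f \<otimes> gh f) \<otimes> ed g)"
      using F cM g by (simp add: mult_assoc[symmetric])
    also have "(\<Oplus>f\<in>F. ed f \<otimes> gh f) \<otimes> ed g = (\<Oplus>f\<in>F. (ed f \<otimes> gh f) \<otimes> ed g)"
      by (rule mult_finsum_left) (use F g in auto)
    also have "\<dots> = \<zero>"
    proof (rule finsum_eq_zero)
      fix f assume f: "f \<in> F"
      then have "(ed f \<otimes> gh f) \<otimes> ed g = ed f \<otimes> (gh f \<otimes> ed g)"
        using F g by (auto intro!: mult_assoc)
      then show "(ed f \<otimes> gh f) \<otimes> ed g = \<zero>"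
        using f F g by (auto simp: gh_ed subset_iff)
    qed
    finally show ?thesis using cM by simp
  qed
  then show ?thesis using that F by blast
qed

lemma hspan_in_ideal: "\<lbrakk>hspan N d a; a \<in> I\<rbrakk> \<Longrightarrow> a = \<zero>"
proof (induction N arbitrary: d a)
  case 0
  then show ?case by (rule hspan_0_in_ideal)
next
  case (Suc N)
  obtain p c where a: "a = p \<oplus> c" and p: "hspan 0 d p" and c: "ghost_part N d c"
    using hspan_Suc_split[OF Suc.prems(1)] by blast
  have pM: "p \<in> carrier M" and cM: "c \<in> carrier M" and aM: "a \<in> carrier M"
    using p c Suc.prems by (auto simp: ghost_part_def)
  have ag: "a \<otimes> ed g = p \<otimes> ed g \<oplus> c \<otimes> ed g" if "g \<in> arcs E" for g
    using that pM cM by (simp add: a mult_add_left)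
  \<comment> \<open>The product lies in \<open>I\<close> and has ghost bound \<open>N\<close>: the
    edge strips a ghost from \<open>c\<close>, and \<open>p\<close> has none.\<close>
  have a0: "a \<otimes> ed g = \<zero>" if g: "g \<in> arcs E" for g
  proof (rule Suc.IH)
    have "hspan N (d + 1) (c \<otimes> ed g)"
      using c g by (simp add: ghost_part_def)
    moreover have "hspan N (d + 1) (p \<otimes> ed g)"
      by (rule hspan_le[OF _ hspan_ed_right[OF p g]]) simp
    ultimately show "hspan N (d + 1) (a \<otimes> ed g)"
      using ag[OF g] hspan.add by simp
    show "a \<otimes> ed g \<in> I"
      using I_right Suc.prems aM g by simp
  qed
  show ?case
  proof (rule eq_zero_if_vx_right[OF aM])
    fix v assume v: "v \<in> verts E"
    let ?S = "{f \<in> arcs E. tail E f = v}"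
    \<comment> \<open>A vertex is a sink, an infinite emitter or regular.\<close>
    consider "?S = {}" | "infinite ?S" | "regular_vertex E v"
      using v unfolding regular_vertex_def by blast
    then show "a \<otimes> vx v = \<zero>"
    proof cases
      case 1
      \<comment> \<open>At a sink no edge has to be checked, so only the ghost-free part
        survives.\<close>
      then have "c \<otimes> vx v = \<zero>"
        by (intro ghost_part_vx_eq_zero[OF c v]) auto
      then have "a \<otimes> vx v = p \<otimes> vx v"
        using v pM cM by (simp add: a mult_add_left)
      moreover have "a \<otimes> vx v \<in> I"
        using I_right Suc.prems aM v by simp
      ultimately show ?thesis
        using hspan_0_in_ideal[OF hspan_vx_right[OF p v]] by simp
    next
      case 2
      obtain F where F: "finite F" "\<And>g. g \<in> arcs E - F \<Longrightarrow> c \<otimes> ed g = \<zero>"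
        using ghost_part_ed_eq_zero[OF c] by blast
      \<comment> \<open>For such an edge both \<open>a\<close> and \<open>c\<close> annihilate
        \<open>ed g\<close>, hence so does \<open>p\<close>, and the source vertex of
        \<open>g\<close> is \<open>v\<close>.\<close>
      from 2 F(1) obtain g where g: "g \<in> ?S" "g \<notin> F"
        by (meson finite_subset subsetI)
      have "p \<otimes> ed g = \<zero>"
        using a0[of g] ag[of g] F(2)[of g] g pM by simp
      then have pv: "p \<otimes> vx v = \<zero>"
        using hspan_0_ed_eq_zero[OF p, of g] g by simp
      have "c \<otimes> vx v = \<zero>"
      proof (rule ghost_part_vx_eq_zero[OF c v])
        fix f assume f: "f \<in> arcs E" "tail E f = v"
        \<comment> \<open>With \<open>p \<otimes> vx v\<close> zero, \<open>p\<close> kills all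
          edges leaving \<open>v\<close>; since \<open>a\<close> kills them too, so does
          \<open>c\<close>.\<close>
        have "p \<otimes> ed f = (p \<otimes> vx v) \<otimes> ed f"
          using f pM v by (auto simp: mult_assoc tail_ed)
        then have "p \<otimes> ed f = \<zero>" using pv f by simp
        then show "c \<otimes> ed f = \<zero>"
          using a0[of f] ag[of f] f cM by simp
      qed
      with pv show ?thesis
        using v pM cM by (simp add: a mult_add_left)
    next
      case 3
      have "a \<otimes> vx v = (\<Oplus>f\<in>?S. a \<otimes> (ed f \<otimes> gh f))"
        unfolding vx_regular[OF 3]
        by (rule mult_finsum_right) (use 3 aM in \<open>auto simp: regular_vertex_def\<close>)
      also have "\<dots> = \<zero>"
      proof (rule finsum_eq_zero)
        fix f assume "f \<in> ?S"
        then show "a \<otimes> (ed f \<otimes> gh f) = \<zero>"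
          using a0[of f] aM mult_assoc[of a "ed f" "gh f"] by simp
      qed
      finally show ?thesis .
    qed
  qed
qed

end

section \<open>Decomposition into homogeneous elements\<close>

definition homogeneous :: "int \<Rightarrow> 'a \<Rightarrow> bool" where
  "homogeneous d a \<longleftrightarrow> (\<exists>N. hspan N d a)"

lemma homogeneous_closed [simp]: "homogeneous d a \<Longrightarrow> a \<in> carrier M"
  by (auto simp: homogeneous_def)

lemma homogeneous_zero: "homogeneous d \<zero>"
  by (auto simp: homogeneous_def intro: hspan.zero)

lemma homogeneous_add:
  assumes "homogeneous d a" "homogeneous d b"
  shows "homogeneous d (a \<oplus> b)"
proof -
  obtain N N' where "hspan N d a" "hspan N' d b"
    using assms by (auto simp: homogeneous_def)
  then have "hspan (max N N') d (a \<oplus> b)"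
    by (intro hspan.add) (auto intro: hspan_le[rotated])
  then show ?thesis by (auto simp: homogeneous_def)
qed

lemma homogeneous_smult: "\<lbrakk>homogeneous d a; k \<in> carrier K\<rbrakk> \<Longrightarrow> homogeneous d (k \<odot> a)"
  unfolding homogeneous_def using hspan_smult by blast

inductive_set homogeneous_sums :: "'a set" where
  single: "homogeneous d a \<Longrightarrow> a \<in> homogeneous_sums"
| add: "\<lbrakk>a \<in> homogeneous_sums; b \<in> homogeneous_sums\<rbrakk> \<Longrightarrow> a \<oplus> b \<in> homogeneous_sums"

lemma homogeneous_sums_closed: "a \<in> homogeneous_sums \<Longrightarrow> a \<in> carrier M"
  by (induction rule: homogeneous_sums.induct) auto

lemma homogeneous_sums_smult:
  "\<lbrakk>a \<in> homogeneous_sums; k \<in> carrier K\<rbrakk> \<Longrightarrow> k \<odot> a \<in> homogeneous_sums"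
  by (induction rule: homogeneous_sums.induct)
    (auto simp: smult_r_distr homogeneous_sums_closed intro: homogeneous_sums.intros homogeneous_smult)

lemma homogeneous_sums_right:
  assumes x: "x \<in> carrier M" and step: "\<And>d a. homogeneous d a \<Longrightarrow> \<exists>e. homogeneous e (a \<otimes> x)"
  shows "a \<in> homogeneous_sums \<Longrightarrow> a \<otimes> x \<in> homogeneous_sums"
proof (induction rule: homogeneous_sums.induct)
  case (single d a)
  then show ?case using step homogeneous_sums.single by blast
qed (auto simp: x mult_add_left homogeneous_sums_closed intro: homogeneous_sums.add)

lemma homogeneous_vx: "v \<in> verts E \<Longrightarrow> homogeneous 0 (vx v)"
  using hspan.path[OF path_span.vertex[of "\<one>\<^bsub>K\<^esub>" v], of 0] by (auto simp: homogeneous_def)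

lemma homogeneous_vx_right: "\<lbrakk>homogeneous d a; v \<in> verts E\<rbrakk> \<Longrightarrow> homogeneous d (a \<otimes> vx v)"
  and homogeneous_ed_right: "\<lbrakk>homogeneous d a; f \<in> arcs E\<rbrakk> \<Longrightarrow> homogeneous (d + 1) (a \<otimes> ed f)"
  and homogeneous_gh_right: "\<lbrakk>homogeneous d a; f \<in> arcs E\<rbrakk> \<Longrightarrow> homogeneous (d - 1) (a \<otimes> gh f)"
  unfolding homogeneous_def using hspan_vx_right hspan_ed_right hspan_gh_right by blast+

lemma homogeneous_ed: "f \<in> arcs E \<Longrightarrow> homogeneous 1 (ed f)"
  using homogeneous_ed_right[OF homogeneous_vx[of "tail E f"], of f] by (simp add: tail_ed)

lemma homogeneous_gh: "f \<in> arcs E \<Longrightarrow> homogeneous (- 1) (gh f)"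
  using homogeneous_gh_right[OF homogeneous_vx[of "head E f"], of f] by (simp add: head_gh)

text \<open>Right multiplication is understood only for single generators. Associativity extends it
  to all elements, which avoids multiplying two arbitrary homogeneous elements.\<close>

lemma homogeneous_sums_eq: "homogeneous_sums = carrier M"
proof
  show "homogeneous_sums \<subseteq> carrier M"
    using homogeneous_sums_closed by blast
  \<comment> \<open>The elements of the additive span whose right multiplication preserves it; they
    form a subalgebra.\<close>
  define S where "S = {x \<in> homogeneous_sums. \<forall>a\<in>homogeneous_sums. a \<otimes> x \<in> homogeneous_sums}"
  have gen: "x \<in> S" if "homogeneous d x" "\<And>d a. homogeneous d a \<Longrightarrow> \<exists>e. homogeneous e (a \<otimes> x)" for d x
    unfolding S_def using that homogeneous_sums_right[of x] by (auto intro: homogeneous_sums.single)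
  show "carrier M \<subseteq> homogeneous_sums"
  proof
    fix x assume "x \<in> carrier M"
    then have "x \<in> S"
    proof (rule generated)
      show "vx ` verts E \<subseteq> S"
        using homogeneous_vx_right by (auto intro!: gen[OF homogeneous_vx])
      show "ed ` arcs E \<subseteq> S"
        using homogeneous_ed_right by (auto intro!: gen[OF homogeneous_ed])
      show "gh ` arcs E \<subseteq> S"
        using homogeneous_gh_right by (auto intro!: gen[OF homogeneous_gh])
      show "\<zero> \<in> S"
        using homogeneous_zero by (auto intro!: gen[OF homogeneous_zero])
      show "y \<oplus> z \<in> S" if "y \<in> S" "z \<in> S" for y z
        using that by (auto simp: S_def mult_add_right homogeneous_sums_closed intro: homogeneous_sums.add)
      show "k \<odot> y \<in> S" if "k \<in> carrier K" "y \<in> S" for k y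
        using that by (auto simp: S_def mult_smult_right homogeneous_sums_closed homogeneous_sums_smult)
      show "y \<otimes> z \<in> S" if "y \<in> S" "z \<in> S" for y z
        using that by (auto simp: S_def mult_assoc[symmetric] homogeneous_sums_closed)
      show "S \<subseteq> carrier M" by (auto simp: S_def homogeneous_sums_closed)
    qed
    then show "x \<in> homogeneous_sums" by (simp add: S_def)
  qed
qed

lemma homogeneous_decomposition:
  assumes "x \<in> carrier M"
  obtains D c where "finite D" "\<And>d. homogeneous d (c d)" "x = finsum M c D"
proof -
  \<comment> \<open>The extra clause that \<open>c\<close> vanishes off \<open>D\<close> allows two
    decompositions to be added over the union of their index sets.\<close>
  have "\<exists>D c. finite D \<and> (\<forall>d. homogeneous d (c d)) \<and> (\<forall>d. d \<notin> D \<longrightarrow> c d = \<zero>) \<and> x = finsum M c D"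
    using assms unfolding homogeneous_sums_eq[symmetric]
  proof (induction rule: homogeneous_sums.induct)
    case (single d a)
    then show ?case
      by (intro exI[of _ "{d}"] exI[of _ "\<lambda>e. if e = d then a else \<zero>"]) (auto simp: homogeneous_zero)
  next
    case (add a b)
    then obtain D c D' c' where
      D: "finite D" "\<And>d. homogeneous d (c d)" "\<And>d. d \<notin> D \<Longrightarrow> c d = \<zero>" "a = finsum M c D" and
      D': "finite D'" "\<And>d. homogeneous d (c' d)" "\<And>d. d \<notin> D' \<Longrightarrow> c' d = \<zero>" "b = finsum M c' D'"
      by blast
    have cl: "c d \<in> carrier M" "c' d \<in> carrier M" for d
      using D(2) D'(2) homogeneous_closed by blast+
    have "a = finsum M c (D \<union> D')"
      unfolding D(4) by (rule add.finprod_mono_neutral_cong_left) (use D(1,3) D'(1) cl in auto)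
    moreover have "b = finsum M c' (D \<union> D')"
      unfolding D'(4) by (rule add.finprod_mono_neutral_cong_left) (use D(1) D'(1,3) cl in auto)
    ultimately have "a \<oplus> b = (\<Oplus>d\<in>D \<union> D'. c d \<oplus> c' d)"
      using finsum_addf[of c "D \<union> D'" c'] cl by simp
    then show ?case
      using D(1-3) D'(1-3) homogeneous_add
      by (intro exI[of _ "D \<union> D'"] exI[of _ "\<lambda>d. c d \<oplus> c' d"]) auto
  qed
  then show ?thesis using that by blast
qed

end

section \<open>Presented algebras\<close>

locale presentation = cring K for K :: "('k, 'm) ring_scheme" +
  fixes X :: "'x set" and rels :: "(('k, 'x) alg_term \<times> ('k, 'x) alg_term) set"
begin

abbreviation "trms \<equiv> alg_terms K X"
abbreviation "P \<equiv> presented_algebra K X rels"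

definition cl :: "('k, 'x) alg_term \<Rightarrow> ('k, 'x) alg_term set" where
  "cl s = alg_cong K X rels `` {s}"

lemma cong_terms: "(s, t) \<in> alg_cong K X rels \<Longrightarrow> s \<in> trms \<and> t \<in> trms"
  by (induction rule: alg_cong.induct) (auto intro: alg_terms.intros)

lemma equiv_cong: "equiv trms (alg_cong K X rels)"
proof (rule equivI)
  show "refl_on trms (alg_cong K X rels)"
    by (auto simp: refl_on_def intro: alg_cong.refl)
  show "sym (alg_cong K X rels)" by (rule symI) (rule alg_cong.sym)
  show "trans (alg_cong K X rels)" by (rule transI) (rule alg_cong.trans)
  show "alg_cong K X rels \<subseteq> trms \<times> trms" using cong_terms by auto
qed

lemma cl_eqI: "(s, t) \<in> alg_cong K X rels \<Longrightarrow> cl s = cl t"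
  unfolding cl_def by (rule equiv_class_eq[OF equiv_cong])

lemma carrier_P: "carrier P = cl ` trms"
  by (auto simp: presented_algebra_def quotient_def cl_def)

lemma cl_closed: "s \<in> trms \<Longrightarrow> cl s \<in> carrier P"
  by (auto simp: carrier_P)

lemma mem_cl: "s' \<in> cl s \<Longrightarrow> (s, s') \<in> alg_cong K X rels"
  by (simp add: cl_def)

lemma cl_self: "s \<in> trms \<Longrightarrow> s \<in> cl s"
  by (simp add: cl_def alg_cong.refl)

lemma UN_cl:
  assumes "s \<in> trms" "\<And>s'. s' \<in> cl s \<Longrightarrow> f s' = C"
  shows "(\<Union>s'\<in>cl s. f s') = C"
  using assms(2) cl_self[OF assms(1)] by blast

lemma cl_mult:
  assumes "s \<in> trms" "t \<in> trms"
  shows "cl s \<otimes>\<^bsub>P\<^esub> cl t = cl (Prod s t)"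
proof -
  have "cl (Prod s' t') = cl (Prod s t)" if "s' \<in> cl s" "t' \<in> cl t" for s' t'
    using that[THEN mem_cl] by (intro cl_eqI alg_cong.sym[OF alg_cong.cong_Prod])
  then have "(\<Union>s'\<in>cl s. \<Union>t'\<in>cl t. cl (Prod s' t')) = cl (Prod s t)"
    by (intro UN_cl assms)
  then show ?thesis
    by (simp add: presented_algebra_def cl_def)
qed

lemma cl_add:
  assumes "s \<in> trms" "t \<in> trms"
  shows "cl s \<oplus>\<^bsub>P\<^esub> cl t = cl (Sum s t)"
proof -
  have "cl (Sum s' t') = cl (Sum s t)" if "s' \<in> cl s" "t' \<in> cl t" for s' t'
    using that[THEN mem_cl] by (intro cl_eqI alg_cong.sym[OF alg_cong.cong_Sum])
  then have "(\<Union>s'\<in>cl s. \<Union>t'\<in>cl t. cl (Sum s' t')) = cl (Sum s t)"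
    by (intro UN_cl assms)
  then show ?thesis
    by (simp add: presented_algebra_def cl_def)
qed

lemma cl_smult:
  assumes "s \<in> trms" "k \<in> carrier K"
  shows "k \<odot>\<^bsub>P\<^esub> cl s = cl (Scale k s)"
proof -
  have "cl (Scale k s') = cl (Scale k s)" if "s' \<in> cl s" for s'
    using mem_cl[OF that] assms by (intro cl_eqI alg_cong.sym[OF alg_cong.cong_Scale])
  then have "(\<Union>s'\<in>cl s. cl (Scale k s')) = cl (Scale k s)"
    by (intro UN_cl assms)
  then show ?thesis
    by (simp add: presented_algebra_def cl_def)
qed

lemma cl_zero: "\<zero>\<^bsub>P\<^esub> = cl Null"
  by (simp add: presented_algebra_def cl_def)

lemmas cl_simps = cl_mult cl_add cl_smult cl_zero alg_terms.intros

lemma cl_cases: "x \<in> carrier P \<Longrightarrow> (\<And>s. s \<in> trms \<Longrightarrow> x = cl s \<Longrightarrow> thesis) \<Longrightarrow> thesis"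
  by (auto simp: carrier_P)

lemma presented_abelian_group: "abelian_group P"
proof (rule abelian_groupI)
  fix x y assume "x \<in> carrier P" "y \<in> carrier P"
  then show "x \<oplus>\<^bsub>P\<^esub> y \<in> carrier P" "x \<oplus>\<^bsub>P\<^esub> y = y \<oplus>\<^bsub>P\<^esub> x"
    by (auto elim!: cl_cases simp: cl_simps cl_closed alg_cong.Sum_comm[THEN cl_eqI])
next
  fix x y z assume "x \<in> carrier P" "y \<in> carrier P" "z \<in> carrier P"
  then show "x \<oplus>\<^bsub>P\<^esub> y \<oplus>\<^bsub>P\<^esub> z = x \<oplus>\<^bsub>P\<^esub> (y \<oplus>\<^bsub>P\<^esub> z)"
    by (auto elim!: cl_cases simp: cl_simps alg_cong.Sum_assoc[THEN cl_eqI])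
next
  fix x assume "x \<in> carrier P"
  then obtain s where s: "s \<in> trms" "x = cl s" by (rule cl_cases)
  have Null: "Null \<in> trms" and Neg: "Neg s \<in> trms" using s by (auto intro: alg_terms.intros)
  show "\<zero>\<^bsub>P\<^esub> \<oplus>\<^bsub>P\<^esub> x = x"
    using alg_cong.trans[OF alg_cong.Sum_comm[OF Null s(1)] alg_cong.Sum_Null[OF s(1)], THEN cl_eqI] s Null
    by (simp add: cl_simps)
  have "cl (Neg s) \<oplus>\<^bsub>P\<^esub> x = \<zero>\<^bsub>P\<^esub>"
    using alg_cong.trans[OF alg_cong.Sum_comm[OF Neg s(1)] alg_cong.Sum_Neg[OF s(1)], THEN cl_eqI] s Neg
    by (simp add: cl_simps)
  then show "\<exists>y\<in>carrier P. y \<oplus>\<^bsub>P\<^esub> x = \<zero>\<^bsub>P\<^esub>"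
    using cl_closed[OF Neg] by blast
qed (simp add: cl_zero cl_closed alg_terms.intros)

lemma presented_assoc_algebra: "assoc_algebra K P"
proof -
  have "Module.module K P"
  proof (rule moduleI)
    show "cring K" by (rule is_cring)
    show "abelian_group P" by (rule presented_abelian_group)
  qed (auto elim!: cl_cases simp: cl_simps cl_closed
      alg_cong.Scale_add[THEN cl_eqI] alg_cong.Scale_Sum[THEN cl_eqI]
      alg_cong.Scale_mult[THEN cl_eqI] alg_cong.Scale_one[THEN cl_eqI])
  then show ?thesis
    by (intro assoc_algebra.intro nonassoc_algebra.intro nonassoc_algebra_axioms.intro assoc_algebra_axioms.intro)
      (auto elim!: cl_cases simp: cl_simps cl_closed
        alg_cong.Prod_assoc[THEN cl_eqI] alg_cong.Prod_Sum_left[THEN cl_eqI] alg_cong.Prod_Sum_right[THEN cl_eqI]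
        alg_cong.Prod_Scale_left[THEN cl_eqI] alg_cong.Prod_Scale_right[THEN cl_eqI])
qed

lemma presented_algebra_generated:
  assumes x: "x \<in> carrier P"
    and gen: "\<And>g. g \<in> X \<Longrightarrow> cl (Gen g) \<in> S" and zero: "\<zero>\<^bsub>P\<^esub> \<in> S"
    and add: "\<And>y z. \<lbrakk>y \<in> S; z \<in> S\<rbrakk> \<Longrightarrow> y \<oplus>\<^bsub>P\<^esub> z \<in> S"
    and mult: "\<And>y z. \<lbrakk>y \<in> S; z \<in> S\<rbrakk> \<Longrightarrow> y \<otimes>\<^bsub>P\<^esub> z \<in> S"
    and smult: "\<And>k y. \<lbrakk>k \<in> carrier K; y \<in> S\<rbrakk> \<Longrightarrow> k \<odot>\<^bsub>P\<^esub> y \<in> S"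
  shows "x \<in> S"
proof -
  interpret P: assoc_algebra K P by (rule presented_assoc_algebra)
  have "cl s \<in> S" if "s \<in> trms" for s
    using that
  proof (induction rule: alg_terms.induct)
    \<comment> \<open>The case of \<open>Neg\<close>, which has no counterpart among the closure
      conditions on \<open>S\<close>: negation is rewritten as scaling by minus one.\<close>
    case (4 s)
    have Neg: "Neg s \<in> trms" using 4 by (auto intro: alg_terms.intros)
    have s0: "cl s \<oplus>\<^bsub>P\<^esub> cl (Neg s) = \<zero>\<^bsub>P\<^esub>"
      using 4 Neg by (simp add: cl_simps) (rule cl_eqI, rule alg_cong.Sum_Neg)
    have "cl (Neg s) = \<ominus>\<^bsub>P\<^esub> cl s"
      using s0 4 Neg cl_closed by (metis P.M.a_comm P.M.minus_equality)
    also have "\<dots> = (\<ominus>\<^bsub>K\<^esub> \<one>\<^bsub>K\<^esub>) \<odot>\<^bsub>P\<^esub> cl s"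
      using 4 cl_closed P.smult_l_minus[of "\<one>\<^bsub>K\<^esub>" "cl s"] by simp
    finally show ?case using smult 4 by simp
  qed (use gen zero add mult smult in \<open>auto simp: cl_mult[symmetric] cl_add[symmetric] cl_smult[symmetric] cl_zero[symmetric]\<close>)
  then show ?thesis using x by (auto simp: carrier_P)
qed

end

lemma leavitt_path_algebra_family:
  fixes K :: "('k, 'm) ring_scheme" and E :: "('v, 'e) pre_digraph"
  assumes "cring K" "wf_digraph E"
  shows "leavitt_family K (leavitt_path_algebra K E) E (\<lambda>v. leavitt_gen K E (Vertex v))
    (\<lambda>f. leavitt_gen K E (Edge f)) (\<lambda>f. leavitt_gen K E (Ghost f))"
proof -
  interpret presentation K "leavitt_gens E" "leavitt_rels E"
    by (rule presentation.intro) fact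
  interpret P: assoc_algebra K P by (rule presented_assoc_algebra)
  have gen: "leavitt_gen K E x = cl (Gen x)" for x
    by (simp add: leavitt_gen_def cl_def)
  have V: "Gen (Vertex v) \<in> trms" if "v \<in> verts E" for v
    using that by (auto simp: leavitt_gens_def intro: alg_terms.intros)
  have Ed: "Gen (Edge f) \<in> trms" "Gen (Ghost f) \<in> trms" if "f \<in> arcs E" for f
    using that by (auto simp: leavitt_gens_def intro: alg_terms.intros)
  have ht: "tail E f \<in> verts E" "head E f \<in> verts E" if "f \<in> arcs E" for f
    using assms(2) that by (auto simp: wf_digraph_def)
  have rel: "cl s = cl t" if "(s, t) \<in> leavitt_rels E" "s \<in> trms" "t \<in> trms" for s t
    using that by (intro cl_eqI alg_cong.rel)
  show ?thesis
    unfolding leavitt_path_algebra_def gen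
  proof (intro leavitt_family.intro leavitt_family_axioms.intro presented_assoc_algebra)
    show "wf_digraph E" by fact
    show "cl (Gen (Vertex v)) \<in> carrier P" if "v \<in> verts E" for v
      using that V cl_closed by blast
    show "cl (Gen (Edge f)) \<in> carrier P" "cl (Gen (Ghost f)) \<in> carrier P" if "f \<in> arcs E" for f
      using that Ed cl_closed by blast+
    show "cl (Gen (Vertex u)) \<otimes>\<^bsub>P\<^esub> cl (Gen (Vertex v)) = (if u = v then cl (Gen (Vertex u)) else \<zero>\<^bsub>P\<^esub>)"
      if "u \<in> verts E" "v \<in> verts E" for u v
      using rel[OF leavitt_rels.vertices[OF that]] that by (auto simp: cl_simps V split: if_splits)
    show "cl (Gen (Vertex (tail E f))) \<otimes>\<^bsub>P\<^esub> cl (Gen (Edge f)) = cl (Gen (Edge f))"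
      "cl (Gen (Edge f)) \<otimes>\<^bsub>P\<^esub> cl (Gen (Vertex (head E f))) = cl (Gen (Edge f))"
      "cl (Gen (Vertex (head E f))) \<otimes>\<^bsub>P\<^esub> cl (Gen (Ghost f)) = cl (Gen (Ghost f))"
      "cl (Gen (Ghost f)) \<otimes>\<^bsub>P\<^esub> cl (Gen (Vertex (tail E f))) = cl (Gen (Ghost f))"
      if "f \<in> arcs E" for f
      using rel[OF leavitt_rels.source_edge[OF that]] rel[OF leavitt_rels.edge_range[OF that]]
        rel[OF leavitt_rels.range_ghost[OF that]] rel[OF leavitt_rels.ghost_source[OF that]] that
      by (auto simp: cl_simps V Ed ht)
    show "cl (Gen (Ghost f)) \<otimes>\<^bsub>P\<^esub> cl (Gen (Edge g)) = (if f = g then cl (Gen (Vertex (head E f))) else \<zero>\<^bsub>P\<^esub>)"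
      if "f \<in> arcs E" "g \<in> arcs E" for f g
      using rel[OF leavitt_rels.ghost_edge[OF that]] that by (auto simp: cl_simps V Ed ht split: if_splits)
    show "cl (Gen (Vertex v)) =
        (\<Oplus>\<^bsub>P\<^esub>f\<in>{f \<in> arcs E. tail E f = v}. cl (Gen (Edge f)) \<otimes>\<^bsub>P\<^esub> cl (Gen (Ghost f)))"
      if "regular_vertex E v" for v
    proof -
      have v: "v \<in> verts E" and fin: "finite {f \<in> arcs E. tail E f = v}"
        using that by (auto simp: regular_vertex_def)
      obtain fs where fs: "set fs = {f \<in> arcs E. tail E f = v}" "distinct fs"
        using finite_distinct_list[OF fin] by blast
      \<comment> \<open>The nested sum in the last relation is turned into a \<open>finsum\<close>;
        distinctness of the list prevents an edge from being counted twice.\<close>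
      have foldr: "foldr (\<lambda>f t. Sum (Prod (Gen (Edge f)) (Gen (Ghost f))) t) gs Null \<in> trms \<and>
          cl (foldr (\<lambda>f t. Sum (Prod (Gen (Edge f)) (Gen (Ghost f))) t) gs Null) =
            (\<Oplus>\<^bsub>P\<^esub>f\<in>set gs. cl (Gen (Edge f)) \<otimes>\<^bsub>P\<^esub> cl (Gen (Ghost f)))"
        if "distinct gs" "set gs \<subseteq> arcs E" for gs
        using that
      proof (induction gs)
        case Nil
        then show ?case by (simp add: cl_zero alg_terms.intros)
      next
        case (Cons g gs)
        have "(\<Oplus>\<^bsub>P\<^esub>f\<in>insert g (set gs). cl (Gen (Edge f)) \<otimes>\<^bsub>P\<^esub> cl (Gen (Ghost f)))
            = cl (Gen (Edge g)) \<otimes>\<^bsub>P\<^esub> cl (Gen (Ghost g)) \<oplus>\<^bsub>P\<^esub>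
              (\<Oplus>\<^bsub>P\<^esub>f\<in>set gs. cl (Gen (Edge f)) \<otimes>\<^bsub>P\<^esub> cl (Gen (Ghost f)))"
          by (rule P.finsum_insert)
            (use Cons.prems Ed cl_closed in \<open>auto intro!: P.mult_closed\<close>)
        with Cons show ?case by (simp add: cl_add[symmetric] cl_mult[symmetric] Ed alg_terms.intros)
      qed
      show ?thesis
        using rel[OF leavitt_rels.regular[OF that fs(2,1)] V[OF v]] foldr[OF fs(2)] fs(1) by auto
    qed
    show "x \<in> S"
      if "x \<in> carrier P" "(\<lambda>v. cl (Gen (Vertex v))) ` verts E \<subseteq> S" "(\<lambda>f. cl (Gen (Edge f))) ` arcs E \<subseteq> S"
        "(\<lambda>f. cl (Gen (Ghost f))) ` arcs E \<subseteq> S" "\<zero>\<^bsub>P\<^esub> \<in> S"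
        "\<And>y z. \<lbrakk>y \<in> S; z \<in> S\<rbrakk> \<Longrightarrow> y \<oplus>\<^bsub>P\<^esub> z \<in> S" "\<And>y z. \<lbrakk>y \<in> S; z \<in> S\<rbrakk> \<Longrightarrow> y \<otimes>\<^bsub>P\<^esub> z \<in> S"
        "\<And>k y. \<lbrakk>k \<in> carrier K; y \<in> S\<rbrakk> \<Longrightarrow> k \<odot>\<^bsub>P\<^esub> y \<in> S" for x S
      using that(1)
      by (rule presented_algebra_generated) (use that(2-) in \<open>auto simp: leavitt_gens_def\<close>)
  qed
qed

section \<open>Graded uniqueness\<close>

theorem theorem7:
  fixes K :: "('k, 'm) ring_scheme"
    and E :: "('v, 'e) pre_digraph"
    and A :: "('k, 'a) module"
    and \<phi> :: "('k, 'v, 'e) leavitt \<Rightarrow> 'a"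
    and \<rho> :: "('k, ('k, 'u) universe) module \<Rightarrow> ('k, 'u) universe \<Rightarrow>
      (('k, 'v, 'e) leavitt, ('k, 'u) universe) tensor \<Rightarrow>
      (('k, 'v, 'e) leavitt, ('k, 'u) universe) tensor"
  assumes "wf_digraph E"
    and "cring K"
    and "nonassoc_algebra K A"
    and "gauge_action K E \<rho>"
    and "\<phi> \<in> alg_hom K (leavitt_path_algebra K E) A"
    and "\<forall>v\<in>verts E. \<forall>r\<in>carrier K - {\<zero>\<^bsub>K\<^esub>}.
      \<phi> (r \<odot>\<^bsub>leavitt_path_algebra K E\<^esub> leavitt_gen K E (Vertex v)) \<noteq> \<zero>\<^bsub>A\<^esub>"
    and "\<exists>\<sigma> :: ('k, ('k, 'u) universe) module \<Rightarrow> ('k, 'u) universe \<Rightarrow>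
        ('a, ('k, 'u) universe) tensor \<Rightarrow> ('a, ('k, 'u) universe) tensor.
      GL1_action K A \<sigma> \<and>
      (\<forall>R z. algebra K R \<longrightarrow> z \<in> Units R \<longrightarrow>
        (\<forall>x\<in>carrier (tensor_algebra K (leavitt_path_algebra K E) R).
          tensor_map K A R \<phi> id (\<rho> R z x) = \<sigma> R z (tensor_map K A R \<phi> id x)))"
  shows "inj_on \<phi> (carrier (leavitt_path_algebra K E))"
proof -
  let ?L = "leavitt_path_algebra K E"
  let ?R = "laurent K :: ('k, ('k, 'u) universe) module"
  define t :: "('k, 'u) universe" where "t = laurent_power K 1"
  interpret K: cring K by fact
  interpret A: nonassoc_algebra K A by fact
  interpret L: leavitt_family K ?L E "\<lambda>v. leavitt_gen K E (Vertex v)"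
      "\<lambda>f. leavitt_gen K E (Edge f)" "\<lambda>f. leavitt_gen K E (Ghost f)"
    by (rule leavitt_path_algebra_family) fact+
  interpret R: algebra K ?R by (rule K.laurent_algebra)
  interpret TL: scalar_extension K ?L ?R
    by (intro scalar_extension.intro L.nonassoc_algebra_axioms R.algebra_axioms)
  interpret TA: scalar_extension K A ?R
    by (intro scalar_extension.intro A.nonassoc_algebra_axioms R.algebra_axioms)
  obtain \<sigma> :: "('k, ('k, 'u) universe) module \<Rightarrow> ('k, 'u) universe \<Rightarrow>
        ('a, ('k, 'u) universe) tensor \<Rightarrow> ('a, ('k, 'u) universe) tensor"
    where \<sigma>: "GL1_action K A \<sigma>"
    and equivariant: "\<And>R z x. \<lbrakk>algebra K R; z \<in> Units R; x \<in> carrier (tensor_algebra K ?L R)\<rbrakk> \<Longrightarrow>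
      tensor_map K A R \<phi> id (\<rho> R z x) = \<sigma> R z (tensor_map K A R \<phi> id x)"
    using assms(7) by blast
  note \<phi> = assms(5)
  have \<phi>_closed: "\<phi> x \<in> carrier A" if "x \<in> carrier ?L" for x
    using \<phi> that by (simp add: alg_hom_def)
  have \<phi>_add: "\<phi> (x \<oplus>\<^bsub>?L\<^esub> y) = \<phi> x \<oplus>\<^bsub>A\<^esub> \<phi> y" if "x \<in> carrier ?L" "y \<in> carrier ?L" for x y
    using \<phi> that by (simp add: alg_hom_def)
  have \<phi>_mult: "\<phi> (x \<otimes>\<^bsub>?L\<^esub> y) = \<phi> x \<otimes>\<^bsub>A\<^esub> \<phi> y" if "x \<in> carrier ?L" "y \<in> carrier ?L" for x y
    using \<phi> that by (simp add: alg_hom_def)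
  have \<phi>_zero: "\<phi> \<zero>\<^bsub>?L\<^esub> = \<zero>\<^bsub>A\<^esub>"
    using \<phi>_add[of "\<zero>\<^bsub>?L\<^esub>" "\<zero>\<^bsub>?L\<^esub>"] \<phi>_closed[of "\<zero>\<^bsub>?L\<^esub>"] by simp
  have t_unit: "t \<in> Units ?R" unfolding t_def by (rule K.laurent_power_Units)
  \<comment> \<open>Stated for any algebra \<open>B\<close>, so that it serves both the gauge action
    and \<open>\<sigma>\<close>.\<close>
  have GL1_hom: "\<tau> ?R t \<in> alg_hom ?R (tensor_algebra K B ?R) (tensor_algebra K B ?R)"
    if "GL1_action K B \<tau>" for B :: "('k, 'b) module" and \<tau>
  proof -
    have "\<tau> ?R \<in> hom (units_of ?R) (aut K B ?R)"
      using that R.algebra_axioms unfolding GL1_action_def by blast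
    then have "\<tau> ?R t \<in> carrier (aut K B ?R)"
      using t_unit by (auto simp: hom_def units_of_def)
    then show ?thesis by (simp add: aut_def alg_Aut_def)
  qed
  have \<rho>_hom: "\<rho> ?R t \<in> alg_hom ?R TL.T TL.T"
    using assms(4) GL1_hom unfolding gauge_action_def by blast
  have \<sigma>_hom: "\<sigma> ?R t \<in> alg_hom ?R TA.T TA.T"
    using \<sigma> by (rule GL1_hom)
  \<comment> \<open>\<open>P d x\<close> says that \<open>x\<close> has weight \<open>d\<close>
    under the gauge action, tested at the variable \<open>t\<close>.\<close>
  define P :: "int \<Rightarrow> ('k, 'v, 'e) leavitt \<Rightarrow> bool" where
    "P d x \<longleftrightarrow> x \<in> carrier ?L \<and> \<rho> ?R t (TL.pure x \<one>\<^bsub>?R\<^esub>) = TL.pure x (laurent_power K d)" for d x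
  have gauge: "(\<forall>u\<in>verts E. \<rho> ?R t (TL.pure (leavitt_gen K E (Vertex u)) \<one>\<^bsub>?R\<^esub>) = TL.pure (leavitt_gen K E (Vertex u)) \<one>\<^bsub>?R\<^esub>) \<and>
      (\<forall>f\<in>arcs E. \<rho> ?R t (TL.pure (leavitt_gen K E (Edge f)) \<one>\<^bsub>?R\<^esub>) = TL.pure (leavitt_gen K E (Edge f)) t) \<and>
      (\<forall>f\<in>arcs E. \<rho> ?R t (TL.pure (leavitt_gen K E (Ghost f)) \<one>\<^bsub>?R\<^esub>) = TL.pure (leavitt_gen K E (Ghost f)) (inv\<^bsub>?R\<^esub> t))"
    using assms(4) R.algebra_axioms t_unit unfolding gauge_action_def Let_def by blast
  have P_vx: "P 0 (leavitt_gen K E (Vertex v))" if "v \<in> verts E" for v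
    using gauge that by (simp add: P_def K.laurent_power_0)
  have P_ed: "P 1 (leavitt_gen K E (Edge f))" and P_gh: "P (- 1) (leavitt_gen K E (Ghost f))"
    if "f \<in> arcs E" for f
    using gauge that by (simp_all add: P_def t_def K.laurent_power_inv)
  have P_zero: "P d \<zero>\<^bsub>?L\<^esub>" for d
    using TL.additive_class_zero[OF \<rho>_hom] by (simp add: P_def TL.pure_zero)
  have P_add: "P d (x \<oplus>\<^bsub>?L\<^esub> y)" if "P d x" "P d y" for d x y
    using \<rho>_hom that by (simp add: P_def alg_hom_def TL.pure_add_left TL.pure_closed)
  have P_mult: "P (d + e) (x \<otimes>\<^bsub>?L\<^esub> y)" if "P d x" "P e y" for d e x y
  proof -
    have x: "x \<in> carrier ?L" and y: "y \<in> carrier ?L" using that by (auto simp: P_def)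
    have "\<rho> ?R t (TL.pure (x \<otimes>\<^bsub>?L\<^esub> y) \<one>\<^bsub>?R\<^esub>) = \<rho> ?R t (TL.pure x \<one>\<^bsub>?R\<^esub> \<otimes>\<^bsub>TL.T\<^esub> TL.pure y \<one>\<^bsub>?R\<^esub>)"
      using x y by (simp add: TL.pure_mult)
    also have "\<dots> = \<rho> ?R t (TL.pure x \<one>\<^bsub>?R\<^esub>) \<otimes>\<^bsub>TL.T\<^esub> \<rho> ?R t (TL.pure y \<one>\<^bsub>?R\<^esub>)"
      using \<rho>_hom x y by (simp add: alg_hom_def TL.pure_closed)
    also have "\<dots> = TL.pure (x \<otimes>\<^bsub>?L\<^esub> y) (laurent_power K (d + e))"
      using that x y by (simp add: P_def TL.pure_mult)
    finally show ?thesis using x y by (simp add: P_def)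
  qed
  have P_smult: "P d (k \<odot>\<^bsub>?L\<^esub> x)" if "k \<in> carrier K" "P d x" for d k x
  proof -
    have x: "x \<in> carrier ?L" using that by (simp add: P_def)
    \<comment> \<open>The image of \<open>k\<close> in the Laurent polynomials, through which
      linearity of \<open>\<rho>\<close> over that ring applies to scalars from
      \<open>K\<close>.\<close>
    let ?k = "k \<odot>\<^bsub>?R\<^esub> \<one>\<^bsub>?R\<^esub>"
    have k: "?k \<in> carrier ?R" using that by simp
    have kr: "TL.pure (k \<odot>\<^bsub>?L\<^esub> x) r = ?k \<odot>\<^bsub>TL.T\<^esub> TL.pure x r" if "r \<in> carrier ?R" for r
      using that \<open>k \<in> carrier K\<close> x by (simp add: TL.pure_balanced TL.pure_smult R.smult_assoc2)
    have "\<rho> ?R t (TL.pure (k \<odot>\<^bsub>?L\<^esub> x) \<one>\<^bsub>?R\<^esub>) = ?k \<odot>\<^bsub>TL.T\<^esub> \<rho> ?R t (TL.pure x \<one>\<^bsub>?R\<^esub>)"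
      using \<rho>_hom x k kr[of "\<one>\<^bsub>?R\<^esub>"] by (simp add: alg_hom_def TL.pure_closed)
    also have "\<dots> = TL.pure (k \<odot>\<^bsub>?L\<^esub> x) (laurent_power K d)"
      using that by (simp add: P_def kr)
    finally show ?thesis using x that by (simp add: P_def)
  qed
  have P_path: "P (int n) p" if "L.path_span n p" for n p
    using that
  proof (induction rule: L.path_span.induct)
    case (edge f n q)
    then show ?case using P_mult[OF P_ed] by simp
  qed (auto intro: P_zero P_smult P_vx P_add)
  have P_hspan: "P d x" if "L.hspan N d x" for N d x
    using that
  proof (induction rule: L.hspan.induct)
    case (ghost f N d b)
    \<comment> \<open>Weights add: \<open>b\<close> has weight \<open>d + 1\<close> and the ghost
      edge has weight \<open>- 1\<close>.\<close>
    then show ?case using P_mult[OF _ P_gh, of "d + 1" b f] by simp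
  qed (auto intro: P_zero P_path P_add)
  have kernel: "a = \<zero>\<^bsub>?L\<^esub>" if a: "a \<in> carrier ?L" and \<phi>a: "\<phi> a = \<zero>\<^bsub>A\<^esub>" for a
  proof -
    obtain D c where D: "finite D" and c: "\<And>d. L.homogeneous d (c d)" and a_eq: "a = finsum ?L c D"
      using L.homogeneous_decomposition[OF a] by blast
    have c_closed: "c d \<in> carrier ?L" for d using c by (rule L.homogeneous_closed)
    have "\<rho> ?R t (TL.pure a \<one>\<^bsub>?R\<^esub>) = \<rho> ?R t (TL.cls (\<Sum>d\<in>D. frag_of (c d, \<one>\<^bsub>?R\<^esub>)))"
      unfolding a_eq using D c_closed by (simp add: TL.pure_finsum)
    also have "\<dots> = TL.cls (\<Sum>d\<in>D. frag_of (c d, laurent_power K d))"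
    proof (rule TL.additive_class_sum[OF \<rho>_hom D])
      fix d
      show "(c d, \<one>\<^bsub>?R\<^esub>) \<in> TL.pairs" using c_closed by simp
      have "P d (c d)" using c[of d] P_hspan by (auto simp: L.homogeneous_def)
      then show "\<rho> ?R t (TL.cls (frag_of (c d, \<one>\<^bsub>?R\<^esub>))) = TL.cls (frag_of (c d, laurent_power K d))"
        by (simp add: P_def pure_tensor_def)
    qed
    finally have \<rho>a: "\<rho> ?R t (TL.pure a \<one>\<^bsub>?R\<^esub>) = TL.cls (\<Sum>d\<in>D. frag_of (c d, laurent_power K d))" .
    have map: "tensor_map K A ?R \<phi> id (TL.cls x) = TA.cls (frag_extend (\<lambda>(a, r). frag_of (\<phi> a, r)) x)" for x
      by (rule class_tensor_map[OF TL.scalar_extension_axioms TA.scalar_extension_axioms \<phi>])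
    \<comment> \<open>Equivariance identifies the sum of the tensors of \<open>\<phi> (c d)\<close>
      and \<open>t\<close> to the power \<open>d\<close> with the image under
      \<open>\<sigma>\<close> of a zero tensor.\<close>
    have "TA.cls (\<Sum>d\<in>D. frag_of (\<phi> (c d), laurent_power K d)) = tensor_map K A ?R \<phi> id (\<rho> ?R t (TL.pure a \<one>\<^bsub>?R\<^esub>))"
      unfolding \<rho>a map using D by (simp add: frag_extend_sum o_def)
    also have "\<dots> = \<sigma> ?R t (tensor_map K A ?R \<phi> id (TL.pure a \<one>\<^bsub>?R\<^esub>))"
      by (rule equivariant[OF R.algebra_axioms t_unit]) (use a in \<open>simp add: TL.pure_closed\<close>)
    also have "tensor_map K A ?R \<phi> id (TL.pure a \<one>\<^bsub>?R\<^esub>) = TA.pure \<zero>\<^bsub>A\<^esub> \<one>\<^bsub>?R\<^esub>"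
      by (simp add: pure_tensor_def map \<phi>a)
    also have "\<sigma> ?R t (TA.pure \<zero>\<^bsub>A\<^esub> \<one>\<^bsub>?R\<^esub>) = TA.cls 0"
      using TA.additive_class_zero[OF \<sigma>_hom] by (simp add: TA.pure_zero)
    finally have null: "(\<Sum>d\<in>D. frag_of (\<phi> (c d), laurent_power K d)) \<in> TA.null"
      by (auto dest: TA.class_eqD)
    have \<phi>c: "\<phi> (c n) = \<zero>\<^bsub>A\<^esub>" if n: "n \<in> D" for n
    proof -
      \<comment> \<open>The coefficient at exponent \<open>n\<close>, where \<open>projl\<close>
        unwraps the copy of the Laurent polynomials in the universe.\<close>
      let ?coeff = "\<lambda>s :: ('k, 'u) universe. projl s n"
      have "(\<Oplus>\<^bsub>A\<^esub>d\<in>D. ?coeff (laurent_power K d) \<odot>\<^bsub>A\<^esub> \<phi> (c d)) = \<zero>\<^bsub>A\<^esub>"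
      proof (rule TA.class_functional_eq_zero[OF D _ _ null])
        show "(\<lambda>d. \<phi> (c d)) \<in> D \<rightarrow> carrier A" using c_closed \<phi>_closed by auto
        show "laurent_power K \<in> D \<rightarrow> carrier ?R" by auto
      qed (auto simp: laurent_def laurent_nth K.laurent_coeff_closed)
      moreover have "(\<Oplus>\<^bsub>A\<^esub>d\<in>D. ?coeff (laurent_power K d) \<odot>\<^bsub>A\<^esub> \<phi> (c d))
          = ?coeff (laurent_power K n) \<odot>\<^bsub>A\<^esub> \<phi> (c n)"
        by (rule A.finsum_eq_single[OF D n])
          (use c_closed \<phi>_closed in \<open>auto simp: laurent_power_def laurent_nth\<close>)
      ultimately show ?thesis
        using c_closed \<phi>_closed by (simp add: laurent_power_def laurent_nth)
    qed
    have "c n = \<zero>\<^bsub>?L\<^esub>" if n: "n \<in> D" for n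
    proof -
      obtain N where "L.hspan N n (c n)" using c[of n] by (auto simp: L.homogeneous_def)
      then show ?thesis
      \<comment> \<open>The ideal is the kernel of \<open>\<phi>\<close>, and the hypothesis on
        multiples of vertices gives its last defining condition. The rotation brings the
        \<open>hspan\<close> premise to the front.\<close>
      proof (rule L.hspan_in_ideal[where I = "{x. \<phi> x = \<zero>\<^bsub>A\<^esub>}", rotated 4])
        show "k = \<zero>\<^bsub>K\<^esub>" if "k \<in> carrier K" "v \<in> verts E"
          "k \<odot>\<^bsub>?L\<^esub> leavitt_gen K E (Vertex v) \<in> {x. \<phi> x = \<zero>\<^bsub>A\<^esub>}" for k v
          using assms(6) that by blast
      qed (use \<phi>c n \<phi>_zero \<phi>_mult \<phi>_closed in auto)
    qed
    then show ?thesis unfolding a_eq by (rule L.finsum_eq_zero)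
  qed
  show ?thesis
  proof (rule inj_onI)
    fix x y assume x: "x \<in> carrier ?L" and y: "y \<in> carrier ?L" and eq: "\<phi> x = \<phi> y"
    have "\<phi> (x \<oplus>\<^bsub>?L\<^esub> \<ominus>\<^bsub>?L\<^esub> y) = \<phi> y \<oplus>\<^bsub>A\<^esub> \<phi> (\<ominus>\<^bsub>?L\<^esub> y)"
      using x y eq by (simp add: \<phi>_add)
    also have "\<dots> = \<phi> (y \<oplus>\<^bsub>?L\<^esub> \<ominus>\<^bsub>?L\<^esub> y)"
      using y by (simp add: \<phi>_add)
    also have "\<dots> = \<zero>\<^bsub>A\<^esub>"
      using y \<phi>_zero by (simp add: L.M.r_neg)
    finally have "x \<oplus>\<^bsub>?L\<^esub> \<ominus>\<^bsub>?L\<^esub> y = \<zero>\<^bsub>?L\<^esub>"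
      using kernel x y by simp
    then show "x = y"
      using x y by (metis L.M.minus_equality L.M.minus_minus L.M.a_inv_closed)
  qed
qed

end
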